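(* There exists a constant $\mu>0$ such that the following holds. Let $p=p(n)$ satisfy $p\gg\frac{\log n}{n}$. Then asymptotically almost surely the random graph $G=G(n,p)$ has the property that every globally $\mu np$-bounded edge-coloring of $G$ contains a rainbow Hamilton cycle.
   Context: $G(n,p)$ is the binomial random graph on $n$ vertices in which each pair of vertices is an edge independently with probability $p$. "Asymptotically almost surely" means with probability tending to $1$ as $n\to\infty$; $p\gg f(n)$ means $p/f(n)\to\infty$. An edge-coloring of a graph is globally $\Delta$-bounded if each color appears on at most $\Delta$ edges. A subgraph is rainbow if all its edges have distinct colors. *)

theory Defs
  imports "HOL-Probability.Probability"
begin

text \<open>
  A simple graph is given by a vertex set and a set of edges, each edge being a
  two-element set of vertices.
\<close>

definition all_pairs :: "'a set \<Rightarrow> 'a set set" where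
  "all_pairs V = {e. e \<subseteq> V \<and> card e = 2}"

text \<open>The distribution of the edge set of \<open>G(n,p)\<close> on the vertex set \<open>{..<n}\<close>.\<close>

definition gnp :: "nat \<Rightarrow> real \<Rightarrow> nat set set pmf" where
  "gnp n p = map_pmf (\<lambda>f. {e \<in> all_pairs {..<n}. f e})
     (Pi_pmf (all_pairs {..<n}) False (\<lambda>_. bernoulli_pmf p))"

text \<open>
  \<open>aas G P\<close>: the random graph whose edge set on \<open>n\<close> vertices is distributed as \<open>G n\<close>
  satisfies \<open>P n\<close> with probability tending to 1.
\<close>

definition aas :: "(nat \<Rightarrow> 'g pmf) \<Rightarrow> (nat \<Rightarrow> 'g \<Rightarrow> bool) \<Rightarrow> bool" where
  "aas G P \<longleftrightarrow> (\<lambda>n. measure_pmf.prob (G n) {E. P n E}) \<longlonglongrightarrow> 1"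

definition much_greater :: "(nat \<Rightarrow> real) \<Rightarrow> (nat \<Rightarrow> real) \<Rightarrow> bool" where
  "much_greater p f \<longleftrightarrow> filterlim (\<lambda>n. p n / f n) at_top sequentially"

text \<open>
  A colouring need not be proper, and is a function whose values outside the edge set
  are irrelevant.
\<close>

definition globally_bounded :: "'e set \<Rightarrow> ('e \<Rightarrow> 'c) \<Rightarrow> real \<Rightarrow> bool" where
  "globally_bounded E c \<Delta> \<longleftrightarrow> (\<forall>k. real (card {e \<in> E. c e = k}) \<le> \<Delta>)"

definition rainbow :: "('e \<Rightarrow> 'c) \<Rightarrow> 'e set \<Rightarrow> bool" where
  "rainbow c H \<longleftrightarrow> inj_on c H"

definition cycle_edges :: "'a list \<Rightarrow> 'a set set" where
  "cycle_edges vs = {{vs ! i, vs ! (Suc i mod length vs)} | i. i < length vs}"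

text \<open>\<open>H\<close> is the edge set of a Hamilton cycle of the graph \<open>(V, E)\<close>.\<close>

definition hamilton_cycle :: "'a set \<Rightarrow> 'a set set \<Rightarrow> 'a set set \<Rightarrow> bool" where
  "hamilton_cycle V E H \<longleftrightarrow> H \<subseteq> E \<and>
     (\<exists>vs. distinct vs \<and> length vs \<ge> 3 \<and> set vs = V \<and> H = cycle_edges vs)"

text \<open>
  Colours are natural numbers. This loses nothing, as a colouring of a finite
  graph uses only finitely many colours.
\<close>

definition rainbow_hamilton_property :: "nat \<Rightarrow> real \<Rightarrow> nat set set \<Rightarrow> bool" where
  "rainbow_hamilton_property n \<Delta> E \<longleftrightarrow>
     (\<forall>c :: nat set \<Rightarrow> nat. globally_bounded E c \<Delta> \<longrightarrow>
        (\<exists>H. hamilton_cycle {..<n} E H \<and> rainbow c H))"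

end

theory Submission imports Defs begin

text \<open>
  Let every vertex choose twelve of its edges. For a suitable choice all the chosen colours are distinct and
  the chosen graph expands small sets by a factor greater than two: both kinds of bad events (two picks of one
  colour; all picks of a set \<open>S\<close> staying inside a set of \<open>3 * card S\<close> vertices) are avoided by a counting
  argument that only needs the minimum degree of \<open>G\<close> and an upper bound on the density of small sets.
  By Posa rotations a non-Hamiltonian expander on \<open>n\<close> vertices has quadratically many boosters, pairs whose
  addition brings it closer to Hamiltonicity. Asymptotically almost surely \<open>G\<close> contains a constant proportion of the
  boosters of each of its expanding subgraphs with at most \<open>15 * n\<close> edges, since there are few such subgraphs.
  The at most \<open>15 * n\<close> colours in use occur on at most \<open>15 * \<mu> * n\<^sup>2 * p\<close> edges, fewer than the available
  boosters if \<open>\<mu>\<close> is small, so boosters with new colours can be added until a Hamilton cycle appears.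
\<close>

section \<open>Avoiding bad events by counting\<close>

text \<open>
  A pair \<open>(J, F)\<close> is a bad event: the restriction of the choice function to \<open>J\<close> is one of those in \<open>F\<close>.
\<close>

definition avoiding :: "('i \<Rightarrow> 'a set) \<Rightarrow> ('i set \<times> ('i \<Rightarrow> 'a) set) set \<Rightarrow> 'i set \<Rightarrow> ('i \<Rightarrow> 'a) set" where
  "avoiding A Q D = {f \<in> PiE D A. \<forall>(J, F) \<in> Q. J \<subseteq> D \<longrightarrow> restrict f J \<notin> F}"

lemma finite_avoiding:
  assumes "finite D" "\<And>i. i \<in> D \<Longrightarrow> finite (A i)"
  shows "finite (avoiding A Q D)"
  using finite_PiE[of D A] assms unfolding avoiding_def by auto

text \<open>Events whose index set leaves the current domain are ignored, so goodness passes to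
  smaller domains; this lets the count on \<open>D - J\<close> bound the extensions that trigger an
  event.\<close>

lemma restrict_avoiding:
  assumes "f \<in> avoiding A Q D" "D' \<subseteq> D"
  shows "restrict f D' \<in> avoiding A Q D'"
proof -
  have "restrict (restrict f D') J = restrict f J" if "J \<subseteq> D'" for J
    using that by (auto simp: restrict_def fun_eq_iff)
  then show ?thesis using assms unfolding avoiding_def by (fastforce simp: PiE_def)
qed

lemma card_avoiding_extensions:
  assumes "finite D" "\<And>j. j \<in> insert i D \<Longrightarrow> finite (A j)" "i \<notin> D"
  shows "card {f \<in> PiE (insert i D) A. restrict f D \<in> avoiding A Q D} = card (A i) * card (avoiding A Q D)"
proof -
  have "bij_betw (\<lambda>(a, g). g(i := a)) (A i \<times> avoiding A Q D) {f \<in> PiE (insert i D) A. restrict f D \<in> avoiding A Q D}"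
    (is "bij_betw ?h ?X ?Y")
  proof (rule bij_betwI[where g = "\<lambda>f. (f i, restrict f D)"])
    have upd: "restrict (g(i := a)) D = g" if "g \<in> avoiding A Q D" for g a
      using that assms(3) unfolding avoiding_def by (auto simp: restrict_def fun_eq_iff PiE_def extensional_def)
    show "?h \<in> ?X \<rightarrow> ?Y"
    proof (rule funcsetI)
      fix x assume "x \<in> ?X"
      then obtain a g where x: "x = (a, g)" "a \<in> A i" "g \<in> avoiding A Q D" by blast
      then have "g(i := a) \<in> PiE (insert i D) A" by (intro PiE_fun_upd) (auto simp: avoiding_def)
      moreover have "restrict (g(i := a)) D \<in> avoiding A Q D" unfolding upd[OF x(3)] by (rule x(3))
      ultimately show "?h x \<in> ?Y" unfolding x(1) by (simp only: split mem_Collect_eq)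
    qed
    show "(\<lambda>f. (f i, restrict f D)) \<in> ?Y \<rightarrow> ?X" by (auto simp: PiE_def)
    show "(\<lambda>f. (f i, restrict f D)) (?h x) = x" if "x \<in> ?X" for x
    proof -
      obtain a g where x: "x = (a, g)" "g \<in> avoiding A Q D" using \<open>x \<in> ?X\<close> by blast
      show ?thesis unfolding x(1) by (simp only: split upd[OF x(2)] fun_upd_same)
    qed
    show "?h ((\<lambda>f. (f i, restrict f D)) f) = f" if "f \<in> ?Y" for f
      using that by (auto simp: restrict_def fun_eq_iff PiE_def extensional_def)
  qed
  from bij_betw_same_card[OF this] show ?thesis by (simp add: card_cartesian_product)
qed

text \<open>
  Rosenfeld's counting argument, in place of the local lemma: an extension of a good choice on \<open>D\<close>
  that triggers \<open>(J, F)\<close> is determined by its restrictions to \<open>J\<close> and to \<open>D - J\<close>, and by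
  induction there are at least \<open>\<beta> ^ (card J - 1)\<close> times fewer good choices on \<open>D - J\<close> than on \<open>D\<close>.
\<close>

lemma avoiding_growth:
  fixes \<beta> :: real
  assumes fI: "finite I" and fA: "\<And>i. i \<in> I \<Longrightarrow> finite (A i)" and fQ: "finite Q"
    and Q: "\<And>J F. (J, F) \<in> Q \<Longrightarrow> finite F" and \<beta>: "\<beta> > 0"
    and sum: "\<And>i. i \<in> I \<Longrightarrow>
      \<beta> + (\<Sum>(J, F)\<in>{(J, F) \<in> Q. i \<in> J}. real (card F) / \<beta> ^ (card J - 1)) \<le> real (card (A i))"
    and "D \<subseteq> I" "i \<in> I - D"
  shows "\<beta> * card (avoiding A Q D) \<le> card (avoiding A Q (insert i D))"
  using assms(7,8)
proof (induction "card D" arbitrary: D i rule: less_induct)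
  case less
  let ?N = "\<lambda>D. real (card (avoiding A Q D))"
  have fD: "finite D" using less.prems fI finite_subset by blast
  have several: "\<beta> ^ card J * ?N (D - J) \<le> ?N D" if "J \<subseteq> D" for J
  proof -
    have "finite J" using that fD finite_subset by blast
    then show ?thesis using that
    proof (induction J rule: finite_induct)
      case (insert j J)
      have eq: "insert j (D - insert j J) = D - J" using insert by auto
      have "card (D - insert j J) < card D"
        using insert fD by (intro psubset_card_mono) auto
      then have "\<beta> * ?N (D - insert j J) \<le> ?N (D - J)"
        using less.hyps[of "D - insert j J" j] less.prems insert eq by auto
      then have "\<beta> ^ card J * (\<beta> * ?N (D - insert j J)) \<le> \<beta> ^ card J * ?N (D - J)"
        using \<beta> by (intro mult_left_mono) auto
      also have "\<dots> \<le> ?N D" using insert by auto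
      finally show ?case using insert by (simp add: mult_ac)
    qed auto
  qed
  define X where "X = {f \<in> PiE (insert i D) A. restrict f D \<in> avoiding A Q D}"
  define Qi where "Qi = {(J, F) \<in> Q. i \<in> J}"
  define Y where "Y = (\<lambda>(J, F). {f \<in> X. J \<subseteq> insert i D \<and> restrict f J \<in> F})"
  have fin: "finite (A j)" if "j \<in> insert i D" for j using that fA less.prems by auto
  have fX: "finite X"
    using finite_PiE[of "insert i D" A] fin fD unfolding X_def by auto
  have cX: "card X = card (A i) * card (avoiding A Q D)"
    unfolding X_def using card_avoiding_extensions[of D i A Q] less.prems fD fin by auto
  \<comment> \<open>If the restriction to \<open>D\<close> is good, an extension can only fail
    through an event that contains the new index \<open>i\<close>.\<close>
  have cover: "X \<subseteq> avoiding A Q (insert i D) \<union> (\<Union>q\<in>Qi. Y q)"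
  proof
    fix f assume f: "f \<in> X"
    show "f \<in> avoiding A Q (insert i D) \<union> (\<Union>q\<in>Qi. Y q)"
    proof (cases "f \<in> avoiding A Q (insert i D)")
      case False
      then obtain J F where JF: "(J, F) \<in> Q" "J \<subseteq> insert i D" "restrict f J \<in> F"
        using f unfolding avoiding_def X_def by auto
      have "i \<in> J"
      proof (rule ccontr)
        assume "i \<notin> J"
        then have J: "J \<subseteq> D" using JF by auto
        then have "restrict (restrict f D) J = restrict f J" by (auto simp: restrict_def fun_eq_iff)
        then show False using f JF J unfolding X_def avoiding_def by fastforce
      qed
      then show ?thesis using JF f unfolding Qi_def Y_def by auto
    qed simp
  qed
  have Y_bound: "real (card (Y (J, F))) \<le> card F / \<beta> ^ (card J - 1) * ?N D" if "(J, F) \<in> Qi" for J F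
  proof (cases "J \<subseteq> insert i D")
    case True
    have iJ: "i \<in> J" and fF: "finite F" using that Q unfolding Qi_def by auto
    have fJ: "finite J" using True fD finite_subset by blast
    have inj: "inj_on (\<lambda>f. (restrict f J, restrict f (D - J))) (Y (J, F))"
    proof (rule inj_onI)
      fix f g assume fg: "f \<in> Y (J, F)" "g \<in> Y (J, F)"
        "(restrict f J, restrict f (D - J)) = (restrict g J, restrict g (D - J))"
      have "f x = g x" for x
      proof (cases "x \<in> insert i D")
        case True
        then have "x \<in> J \<or> x \<in> D - J" using iJ by auto
        then show ?thesis using fg(3) by (auto simp: restrict_def fun_eq_iff split: if_splits)
      next
        case False
        then show ?thesis using fg(1,2) unfolding Y_def X_def by (auto simp: PiE_def extensional_def)
      qed
      then show "f = g" by auto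
    qed
    have "(\<lambda>f. (restrict f J, restrict f (D - J))) ` Y (J, F) \<subseteq> F \<times> avoiding A Q (D - J)"
    proof (rule image_subsetI)
      fix f assume f: "f \<in> Y (J, F)"
      have "restrict (restrict f D) (D - J) \<in> avoiding A Q (D - J)"
        using f restrict_avoiding[of "restrict f D" A Q D "D - J"] unfolding Y_def X_def by auto
      moreover have "restrict (restrict f D) (D - J) = restrict f (D - J)"
        by (auto simp: restrict_def fun_eq_iff)
      ultimately show "(restrict f J, restrict f (D - J)) \<in> F \<times> avoiding A Q (D - J)"
        using f unfolding Y_def by auto
    qed
    then have "card (Y (J, F)) \<le> card (F \<times> avoiding A Q (D - J))"
      using inj fF fD fin by (intro card_inj_on_le[OF inj]) (auto intro!: finite_avoiding)
    then have 1: "real (card (Y (J, F))) \<le> card F * ?N (D - J)"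
      by (metis card_cartesian_product of_nat_le_iff of_nat_mult)
    \<comment> \<open>As \<open>i\<close> lies outside \<open>D\<close>, only the other
      \<open>card J - 1\<close> indices of \<open>J\<close> are removed from \<open>D\<close>; hence
      the exponent in the weights.\<close>
    have "D - (J - {i}) = D - J" using less.prems by auto
    moreover have "card (J - {i}) = card J - 1" using iJ fJ by simp
    moreover have "J - {i} \<subseteq> D" using True by auto
    ultimately have "\<beta> ^ (card J - 1) * ?N (D - J) \<le> ?N D" using several[of "J - {i}"] by simp
    then have "?N (D - J) \<le> ?N D / \<beta> ^ (card J - 1)" using \<beta> by (simp add: field_simps)
    then have "card F * ?N (D - J) \<le> card F * (?N D / \<beta> ^ (card J - 1))" by (intro mult_left_mono) auto
    then show ?thesis using 1 by simp
  next
    case False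
    then have "Y (J, F) = {}" unfolding Y_def by auto
    then show ?thesis using \<beta> by simp
  qed
  have fQi: "finite Qi" unfolding Qi_def using fQ by (auto intro: finite_subset)
  have fav: "finite (avoiding A Q (insert i D))" by (rule finite_avoiding) (use fD fin in auto)
  have "card X \<le> card (avoiding A Q (insert i D) \<union> (\<Union>q\<in>Qi. Y q))"
  proof (rule card_mono[OF _ cover])
    have "finite (\<Union>q\<in>Qi. Y q)" using fQi fX by (auto intro!: finite_UN_I finite_subset[OF _ fX] simp: Y_def)
    then show "finite (avoiding A Q (insert i D) \<union> (\<Union>q\<in>Qi. Y q))" using fav by simp
  qed
  also have "\<dots> \<le> card (avoiding A Q (insert i D)) + (\<Sum>q\<in>Qi. card (Y q))"
    using card_UN_le[OF fQi, of Y] card_Un_le[of "avoiding A Q (insert i D)" "\<Union>q\<in>Qi. Y q"] by linarith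
  finally have "real (card X) \<le> ?N (insert i D) + (\<Sum>q\<in>Qi. real (card (Y q)))"
    by (metis of_nat_add of_nat_le_iff of_nat_sum)
  also have "(\<Sum>q\<in>Qi. real (card (Y q))) \<le> (\<Sum>(J, F)\<in>Qi. card F / \<beta> ^ (card J - 1) * ?N D)"
    using Y_bound by (intro sum_mono) auto
  also have "\<dots> = (\<Sum>(J, F)\<in>Qi. card F / \<beta> ^ (card J - 1)) * ?N D"
    by (simp add: sum_distrib_right case_prod_unfold)
  also have "\<dots> \<le> (card (A i) - \<beta>) * ?N D"
    using sum[of i] less.prems unfolding Qi_def by (intro mult_right_mono) auto
  finally show ?case unfolding cX by (simp add: algebra_simps)
qed

text \<open>The only function on the empty domain is good because no event has an empty index set,
  and each growth step multiplies the count by at least \<beta> > 0.\<close>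

lemma avoiding_nonempty:
  fixes \<beta> :: real
  assumes fI: "finite I" and "\<And>i. i \<in> I \<Longrightarrow> finite (A i)" and "finite Q"
    and Q: "\<And>J F. (J, F) \<in> Q \<Longrightarrow> finite F \<and> J \<noteq> {}" and \<beta>: "\<beta> > 0"
    and "\<And>i. i \<in> I \<Longrightarrow>
      \<beta> + (\<Sum>(J, F)\<in>{(J, F) \<in> Q. i \<in> J}. real (card F) / \<beta> ^ (card J - 1)) \<le> real (card (A i))"
  shows "avoiding A Q I \<noteq> {}"
proof -
  have "D \<subseteq> I \<Longrightarrow> card (avoiding A Q D) > 0" if "finite D" for D
    using that
  proof (induction D rule: finite_induct)
    case empty
    then have "avoiding A Q {} = {\<lambda>_. undefined}" using Q unfolding avoiding_def by auto
    then show ?case by simp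
  next
    case (insert i D)
    have "0 < \<beta> * card (avoiding A Q D)" using insert \<beta> by auto
    also have "\<dots> \<le> card (avoiding A Q (insert i D))"
      using assms insert by (intro avoiding_growth[of I]) auto
    finally show ?case by auto
  qed
  then show ?thesis using fI by fastforce
qed

section \<open>Rotations and boosters\<close>

fun path_edges :: "'a list \<Rightarrow> 'a set set" where
  "path_edges (x # y # zs) = insert {x, y} (path_edges (y # zs))"
| "path_edges _ = {}"

lemma path_edges_Cons: "path_edges (x # xs) = (if xs = [] then {} else insert {x, hd xs} (path_edges xs))"
  by (cases xs) auto

lemma path_edges_append:
  "path_edges (xs @ ys) =
     path_edges xs \<union> path_edges ys \<union> (if xs = [] \<or> ys = [] then {} else {{last xs, hd ys}})"
  by (induction xs) (auto simp: path_edges_Cons)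

lemma path_edges_rev [simp]: "path_edges (rev xs) = path_edges xs"
  by (induction xs) (auto simp: path_edges_Cons path_edges_append last_rev insert_commute)

lemma path_edges_subset: "e \<in> path_edges vs \<Longrightarrow> e \<subseteq> set vs"
  by (induction vs rule: path_edges.induct) auto

lemma finite_path_edges [simp]: "finite (path_edges vs)"
  by (induction vs rule: path_edges.induct) auto

lemma nth_path_edges: "Suc i < length vs \<Longrightarrow> {vs ! i, vs ! Suc i} \<in> path_edges vs"
proof (induction vs arbitrary: i rule: path_edges.induct)
  case (1 x y zs)
  then show ?case by (cases i) auto
qed auto

lemma path_degree:
  "distinct vs \<Longrightarrow> y \<in> set vs \<Longrightarrow>
     card {e \<in> path_edges vs. y \<in> e} = (if y = hd vs then 0 else 1) + (if y = last vs then 0 else 1)"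
proof (induction vs rule: path_edges.induct)
  case (1 x z zs)
  have x: "x \<notin> e" and xz: "{x, z} \<noteq> e" if "e \<in> path_edges (z # zs)" for e
    using path_edges_subset[OF that] 1 by auto
  show ?case
  proof (cases "y = x")
    case True
    then have eq: "{e \<in> path_edges (x # z # zs). y \<in> e} = {{x, z}}" using x by auto
    have "last (z # zs) \<noteq> x" using 1(2) by (metis distinct.simps(2) last_in_set list.distinct(1))
    then show ?thesis unfolding eq using True by simp
  next
    case False
    then have yz: "y \<in> set (z # zs)" using 1(3) by simp
    have d: "distinct (z # zs)" using 1(2) by simp
    note IH = 1(1)[OF d yz]
    show ?thesis
    proof (cases "y = z")
      case True
      then have eq: "{e \<in> path_edges (x # z # zs). y \<in> e} = insert {x, z} {e \<in> path_edges (z # zs). y \<in> e}" by auto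
      have "{x, z} \<notin> {e \<in> path_edges (z # zs). y \<in> e}" using xz by blast
      then have "card (insert {x, z} {e \<in> path_edges (z # zs). y \<in> e}) = Suc (card {e \<in> path_edges (z # zs). y \<in> e})"
        by (intro card_insert_disjoint) auto
      then show ?thesis unfolding eq IH using True False by simp
    next
      case yz: False
      then have eq: "{e \<in> path_edges (x # z # zs). y \<in> e} = {e \<in> path_edges (z # zs). y \<in> e}" using False by auto
      show ?thesis unfolding eq IH using yz False by simp
    qed
  qed
qed auto

definition is_path :: "'a set \<Rightarrow> 'a set set \<Rightarrow> 'a list \<Rightarrow> bool" where
  "is_path V R vs \<longleftrightarrow> distinct vs \<and> set vs \<subseteq> V \<and> path_edges vs \<subseteq> R"

text \<open>Length counts vertices. The empty list is a path, so the maximum is over a nonempty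
  set.\<close>

definition longest_path :: "'a set \<Rightarrow> 'a set set \<Rightarrow> nat" where
  "longest_path V R = Max (length ` {vs. is_path V R vs})"

definition nbhd :: "'a set set \<Rightarrow> 'a set \<Rightarrow> 'a set" where
  "nbhd R S = {y. \<exists>x\<in>S. {x, y} \<in> R} - S"

text \<open>The strict factor two is exactly what Posa's bound on the neighbourhood of the endpoints
  contradicts.\<close>

definition expander :: "'a set \<Rightarrow> 'a set set \<Rightarrow> nat \<Rightarrow> bool" where
  "expander V R s \<longleftrightarrow> (\<forall>S\<subseteq>V. S \<noteq> {} \<and> card S \<le> s \<longrightarrow> 2 * card S < card (nbhd R S))"

definition has_cycle :: "'a set \<Rightarrow> 'a set set \<Rightarrow> nat \<Rightarrow> bool" where
  "has_cycle V R l \<longleftrightarrow> (\<exists>vs. is_path V R vs \<and> length vs = l \<and> l \<ge> 3 \<and> {last vs, hd vs} \<in> R)"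

text \<open>
  Adding an edge between the ends of a longest path need not lengthen it when the graph is disconnected;
  the parity bit records the progress made by closing it to a cycle. Hence no connectivity is needed.
\<close>

definition cycle_potential :: "'a set \<Rightarrow> 'a set set \<Rightarrow> nat" where
  "cycle_potential V R = 2 * longest_path V R + (if has_cycle V R (longest_path V R) then 1 else 0)"

definition boosters :: "'a set \<Rightarrow> 'a set set \<Rightarrow> 'a set set" where
  "boosters V R = {e \<in> all_pairs V. cycle_potential V R < cycle_potential V (insert e R)}"

lemma boosters_disjoint: "boosters V R \<inter> R = {}"
  unfolding boosters_def by (auto simp: insert_absorb)

lemma finite_all_pairs: "finite V \<Longrightarrow> finite (all_pairs V)"
  unfolding all_pairs_def by (rule finite_subset[of _ "Pow V"]) auto

lemma nbhd_subset: "R \<subseteq> all_pairs V \<Longrightarrow> nbhd R S \<subseteq> V"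
  unfolding nbhd_def all_pairs_def by auto

lemma expanderD:
  "expander V R s \<Longrightarrow> S \<subseteq> V \<Longrightarrow> S \<noteq> {} \<Longrightarrow> card S \<le> s \<Longrightarrow> 2 * card S < card (nbhd R S)"
  unfolding expander_def by simp

lemma expander_mono:
  assumes "expander V R s" "R \<subseteq> R'" "finite V" "R' \<subseteq> all_pairs V"
  shows "expander V R' s"
proof -
  have "card (nbhd R S) \<le> card (nbhd R' S)" for S
    using assms by (intro card_mono finite_subset[OF nbhd_subset[OF assms(4)]]) (auto simp: nbhd_def)
  then show ?thesis using assms(1) unfolding expander_def by (meson less_le_trans)
qed

lemma finite_paths: "finite V \<Longrightarrow> finite {vs. is_path V R vs}"
proof (rule finite_subset)
  show "{vs. is_path V R vs} \<subseteq> {vs. set vs \<subseteq> V \<and> length vs \<le> card V}" if "finite V"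
    using that by (auto simp: is_path_def) (metis card_mono distinct_card)
qed (rule finite_lists_length_le)

lemma longest_path_ge: "finite V \<Longrightarrow> is_path V R vs \<Longrightarrow> length vs \<le> longest_path V R"
  unfolding longest_path_def using finite_paths[of V R] by (intro Max_ge) auto

lemma longest_path_obtain:
  assumes "finite V"
  obtains P where "is_path V R P" "length P = longest_path V R"
proof -
  have "is_path V R []" by (simp add: is_path_def)
  then have "longest_path V R \<in> length ` {vs. is_path V R vs}"
    unfolding longest_path_def using finite_paths[OF assms, of R] by (intro Max_in) auto
  then show ?thesis using that by auto
qed

lemma longest_path_mono: "finite V \<Longrightarrow> R \<subseteq> R' \<Longrightarrow> longest_path V R \<le> longest_path V R'"
  by (metis longest_path_obtain longest_path_ge is_path_def subset_trans)

lemma longest_path_le: "finite V \<Longrightarrow> longest_path V R \<le> card V"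
  by (metis longest_path_obtain is_path_def distinct_card card_mono)

lemma cycle_potential_le: "finite V \<Longrightarrow> cycle_potential V R \<le> 2 * card V + 1"
  using longest_path_le[of V R] by (simp add: cycle_potential_def)

section \<open>Posa rotations with a fixed first vertex\<close>

inductive_set rotations :: "'a set set \<Rightarrow> 'a list \<Rightarrow> 'a list set" for R P where
  base: "P \<in> rotations R P"
| rotate: "xs @ y # ys \<in> rotations R P \<Longrightarrow> ys \<noteq> [] \<Longrightarrow> {last ys, y} \<in> R \<Longrightarrow> xs @ y # rev ys \<in> rotations R P"

lemma rotations_path:
  assumes "Q \<in> rotations R P" "is_path V R P"
  shows "is_path V R Q \<and> set Q = set P \<and> hd Q = hd P \<and> length Q = length P"
  using assms
proof (induction rule: rotations.induct)
  case (rotate xs y ys)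
  then have IH: "is_path V R (xs @ y # ys)" "set (xs @ y # ys) = set P" "hd (xs @ y # ys) = hd P"
    "length (xs @ y # ys) = length P" by auto
  have "path_edges (xs @ y # rev ys) \<subseteq> insert {last ys, y} (path_edges (xs @ y # ys))"
    by (auto simp: path_edges_append path_edges_Cons hd_rev)
  then have "is_path V R (xs @ y # rev ys)" using IH(1) rotate(3) unfolding is_path_def by auto
  moreover have "hd (xs @ y # rev ys) = hd P" using IH(3) by (cases xs) auto
  ultimately show ?case using IH by auto
qed simp

text \<open>A rotation deletes only the edge from the pivot \<open>y\<close> to its successor
  \<open>hd ys\<close>, and that successor becomes the new last vertex. So each deleted edge meets
  the set of endpoints.\<close>

lemma rotations_kept_edges:
  assumes "Q \<in> rotations R P" "e \<in> path_edges P" "e \<inter> last ` rotations R P = {}"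
  shows "e \<in> path_edges Q"
  using assms
proof (induction rule: rotations.induct)
  case (rotate xs y ys)
  have "last (xs @ y # rev ys) \<in> last ` rotations R P" using rotations.rotate[OF rotate(1-3)] by blast
  then have "hd ys \<in> last ` rotations R P" using rotate(2) by (simp add: last_rev)
  then have "e \<noteq> {y, hd ys}" using rotate by blast
  moreover have "e \<in> path_edges (xs @ y # ys)" using rotate by blast
  ultimately show ?case using rotate(2) by (auto simp: path_edges_append path_edges_Cons split: if_splits)
qed simp

text \<open>
  An edge of \<open>P\<close> not meeting the set \<open>T\<close> of endpoints survives all rotations. So a vertex outside \<open>T\<close>
  without a \<open>P\<close>-neighbour in \<open>T\<close> has the same neighbours on every rotated path, and a further edge from it
  to an endpoint would rotate one of these neighbours into \<open>T\<close>.
\<close>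

lemma posa:
  assumes V: "finite V" "R \<subseteq> all_pairs V" and P: "is_path V R P" "length P = longest_path V R" "P \<noteq> []"
  defines "T \<equiv> last ` rotations R P"
  shows "card (nbhd R T) \<le> 2 * card T"
proof -
  have TV: "T \<subseteq> set P"
  proof
    fix x assume "x \<in> T"
    then obtain Q where "Q \<in> rotations R P" "x = last Q" unfolding T_def by auto
    then show "x \<in> set P" using rotations_path[OF _ P(1), of Q] P(3)
      by (metis last_in_set length_0_conv)
  qed
  then have fT: "finite T" using finite_subset by auto
  define M where "M x = {y. {x, y} \<in> path_edges P}" for x
  have M: "card (M x) \<le> 2 \<and> finite (M x)" if "x \<in> set P" for x
  proof -
    have i: "inj_on (\<lambda>y. {x, y}) (M x)" by (auto simp: inj_on_def doubleton_eq_iff)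
    have sub: "(\<lambda>y. {x, y}) ` M x \<subseteq> {e \<in> path_edges P. x \<in> e}" unfolding M_def by auto
    have "card (M x) \<le> card {e \<in> path_edges P. x \<in> e}" using sub by (intro card_inj_on_le[OF i]) auto
    also have "\<dots> \<le> 2" using path_degree[of P x] P that unfolding is_path_def by auto
    finally show ?thesis using inj_on_finite[OF i sub] by auto
  qed
  have "nbhd R T \<subseteq> (\<Union>x\<in>T. M x)"
  proof
    fix y assume "y \<in> nbhd R T"
    then obtain Q where Q: "Q \<in> rotations R P" "{last Q, y} \<in> R" and y: "y \<notin> T"
      unfolding nbhd_def T_def by auto
    note Qp = rotations_path[OF Q(1) P(1)]
    have yV: "y \<in> V" using Q(2) V(2) unfolding all_pairs_def by auto
    have Q0: "Q \<noteq> []" using Qp P(3) by auto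
    \<comment> \<open>Rotations preserve the length, so \<open>Q\<close> is again a longest path and
      cannot be extended by \<open>y\<close>.\<close>
    have "y \<in> set Q"
    proof (rule ccontr)
      assume "y \<notin> set Q"
      then have "is_path V R (Q @ [y])" using Qp Q(2) yV Q0 by (auto simp: is_path_def path_edges_append)
      then show False using longest_path_ge[OF V(1)] Qp P(2) by fastforce
    qed
    then obtain xs ys where Qe: "Q = xs @ y # ys" by (meson split_list)
    have lQ: "last Q \<in> T" and lP: "last P \<in> T" unfolding T_def using Q(1) rotations.base by auto
    have ys: "ys \<noteq> []" using lQ y Qe by auto
    then have "xs @ y # rev ys \<in> rotations R P" using Q Qe by (intro rotations.rotate) auto
    then have "last (xs @ y # rev ys) \<in> T" unfolding T_def by blast
    then have z: "hd ys \<in> T" using ys by (simp add: last_rev)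
    show "y \<in> (\<Union>x\<in>T. M x)"
    proof (rule ccontr)
      assume no: "y \<notin> (\<Union>x\<in>T. M x)"
      have "{e \<in> path_edges P. y \<in> e} \<subseteq> {e \<in> path_edges Q. y \<in> e}"
      proof clarify
        fix e assume e: "e \<in> path_edges P" "y \<in> e"
        have "e \<in> all_pairs V" using e P(1) V(2) unfolding is_path_def by blast
        then have "card e = 2" unfolding all_pairs_def by simp
        then obtain x where x: "e = {x, y}" using e(2) by (metis card_2_iff insert_commute insertE singletonD)
        then have "x \<notin> T" using no e(1) unfolding M_def by auto
        then have "e \<inter> T = {}" using x y by auto
        then show "e \<in> path_edges Q" using rotations_kept_edges[OF Q(1) e(1)] unfolding T_def by blast
      qed
      \<comment> \<open>The paths share their head and \<open>y\<close> is last on neither, so the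
        degrees of \<open>y\<close> agree and the inclusion becomes an equality.\<close>
      moreover have "card {e \<in> path_edges P. y \<in> e} = card {e \<in> path_edges Q. y \<in> e}"
        using path_degree[of P y] path_degree[of Q y] Qp P(1) \<open>y \<in> set Q\<close> lP lQ y
        unfolding is_path_def by auto
      ultimately have "{e \<in> path_edges P. y \<in> e} = {e \<in> path_edges Q. y \<in> e}"
        by (intro card_subset_eq) auto
      moreover have "{y, hd ys} \<in> path_edges Q" using ys Qe by (auto simp: path_edges_append path_edges_Cons)
      ultimately have "{hd ys, y} \<in> path_edges P" by (auto simp: insert_commute)
      then show False using no z unfolding M_def by auto
    qed
  qed
  then have "card (nbhd R T) \<le> card (\<Union>x\<in>T. M x)" using M TV fT by (intro card_mono) auto
  also have "\<dots> \<le> (\<Sum>x\<in>T. card (M x))" by (rule card_UN_le[OF fT])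
  also have "\<dots> \<le> (\<Sum>x\<in>T. 2)" using M TV by (intro sum_mono) auto
  finally show ?thesis by simp
qed

text \<open>By \<open>posa\<close> the endpoints of a longest path do not expand by more than a
  factor two, so they must be too numerous for the expansion hypothesis.\<close>

lemma many_endpoints:
  assumes V: "finite V" "R \<subseteq> all_pairs V" and e: "expander V R s"
    and P: "is_path V R P" "length P = longest_path V R" "P \<noteq> []"
  shows "s < card (last ` rotations R P)"
proof (rule ccontr)
  let ?T = "last ` rotations R P"
  assume "\<not> s < card ?T"
  moreover have "?T \<subseteq> V"
  proof clarify
    fix Q assume "Q \<in> rotations R P"
    then show "last Q \<in> V" using rotations_path[OF _ P(1), of Q] P unfolding is_path_def
      by (metis last_in_set length_0_conv subsetD)
  qed
  moreover have "?T \<noteq> {}" using rotations.base by auto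
  ultimately have "2 * card ?T < card (nbhd R ?T)" using expanderD[OF e] by simp
  then show False using posa[OF V P] by simp
qed

section \<open>Counting boosters of a non-Hamiltonian expander\<close>

lemma card_pairs_le:
  assumes "finite E"
  shows "card {(x, y). {x, y} \<in> E} \<le> 2 * card E" and "finite {(x, y). {x, y} \<in> E}"
proof -
  have *: "card {(x, y). {x, y} = e} \<le> 2 \<and> finite {(x, y). {x, y} = e}" for e :: "'a set"
  proof (cases "\<exists>a b. e = {a, b}")
    case True
    then obtain a b where ab: "e = {a, b}" by auto
    have "{(x, y). {x, y} = e} \<subseteq> {(a, b), (b, a)}" unfolding ab by (auto simp: doubleton_eq_iff)
    then show ?thesis using card_mono[of "{(a, b), (b, a)}"] finite_subset
      by (smt (verit) card_2_iff' card.empty card_insert_if finite.emptyI finite_insert le_trans one_le_numeral numeral_2_eq_2 One_nat_def order_refl empty_iff Suc_le_mono)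
  next
    case False
    then have "{(x, y). {x, y} = e} = {}" by auto
    then show ?thesis by simp
  qed
  have eq: "{(x, y). {x, y} \<in> E} = (\<Union>e\<in>E. {(x, y). {x, y} = e})" by auto
  then show "finite {(x, y). {x, y} \<in> E}" using * assms by auto
  have "card {(x, y). {x, y} \<in> E} \<le> (\<Sum>e\<in>E. card {(x, y). {x, y} = e})"
    unfolding eq by (rule card_UN_le[OF assms])
  also have "\<dots> \<le> (\<Sum>e\<in>E. 2)" using * by (intro sum_mono) auto
  finally show "card {(x, y). {x, y} \<in> E} \<le> 2 * card E" by simp
qed

text \<open>The cycle is traversed from the successor of \<open>w\<close> round to \<open>w\<close>,
  and \<open>z\<close> is appended.\<close>

lemma cycle_extend:
  assumes P: "is_path V R P" "{last P, hd P} \<in> R" and wz: "w \<in> set P" "z \<in> V - set P"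
  obtains Q where "is_path V (insert {w, z} R) Q" "length Q = Suc (length P)"
proof -
  obtain xs ys where P': "P = xs @ w # ys" using wz(1) by (meson split_list)
  have "path_edges (ys @ xs @ [w, z]) \<subseteq> insert {w, z} (insert {last P, hd P} (path_edges P))"
    unfolding P' by (cases xs; cases ys) (auto simp: path_edges_append path_edges_Cons hd_append split: if_splits)
  then have "is_path V (insert {w, z} R) (ys @ xs @ [w, z])"
    using P wz P' unfolding is_path_def by auto
  then show ?thesis using that P' by auto
qed

lemma cycle_hamilton:
  assumes "is_path V R P" "{last P, hd P} \<in> R" "length P \<ge> 3" "set P = V"
  shows "\<exists>H. hamilton_cycle V R H"
proof -
  have "{P ! i, P ! (Suc i mod length P)} \<in> R" if "i < length P" for i
  proof (cases "Suc i < length P")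
    case True
    then show ?thesis using nth_path_edges[of i P] assms unfolding is_path_def by auto
  next
    case False
    then have "Suc i = length P" using that by simp
    moreover have "P \<noteq> []" using assms(3) by auto
    ultimately have "P ! i = last P" "P ! (Suc i mod length P) = hd P"
      by (simp_all add: last_conv_nth hd_conv_nth flip: \<open>Suc i = length P\<close>)
    then show ?thesis using assms by simp
  qed
  then have "cycle_edges P \<subseteq> R" unfolding cycle_edges_def by auto
  then show ?thesis using assms unfolding hamilton_cycle_def is_path_def by blast
qed

text \<open>If no cycle has as many vertices as a longest path, joining the two ends of any longest
  path is a booster; more than \<open>s\<close> ends arise by rotation, each with more than
  \<open>s\<close> partners, and unordered pairs are counted at most twice. If there is such a
  cycle, an edge leaving its vertex set \<open>W\<close> would give a longer path. So
  \<open>W\<close> and its complement have empty neighbourhoods, expansion makes both larger than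
  \<open>s\<close>, and every pair between them is a booster.\<close>

lemma many_boosters:
  assumes V: "finite V" "V \<noteq> {}" "R \<subseteq> all_pairs V" and e: "expander V R s" and s: "s \<ge> 1"
    and nH: "\<not> (\<exists>H. hamilton_cycle V R H)"
  shows "s * s \<le> 2 * card (boosters V R)"
proof -
  let ?L = "longest_path V R"
  have fB: "finite (boosters V R)" unfolding boosters_def using finite_all_pairs[OF V(1)] by auto
  \<comment> \<open>Closing a path counts as a cycle only from three vertices on; two neighbours of
    one vertex supply them.\<close>
  have L3: "?L \<ge> 3"
  proof -
    obtain v where v: "v \<in> V" using V(2) by auto
    then have "card (nbhd R {v}) > 2" using expanderD[OF e, of "{v}"] s by simp
    then obtain a where a: "a \<in> nbhd R {v}" by fastforce
    have "card (nbhd R {v} - {a}) > 0" using \<open>card (nbhd R {v}) > 2\<close> a by (simp add: card_Diff_singleton)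
    then obtain b where b: "b \<in> nbhd R {v}" "b \<noteq> a" by (metis Diff_iff card_gt_0_iff ex_in_conv insertCI)
    have "is_path V R [a, v, b]" using a b v nbhd_subset[OF V(3), of "{v}"]
      unfolding is_path_def nbhd_def by (auto simp: insert_commute)
    then show ?thesis using longest_path_ge[OF V(1)] by fastforce
  qed
  show ?thesis
  proof (cases "has_cycle V R ?L")
    case False
    define Z where "Z = {(x, y). \<exists>Q. is_path V R Q \<and> length Q = ?L \<and> hd Q = x \<and> last Q = y}"
    have ZB: "Z \<subseteq> {(x, y). {x, y} \<in> boosters V R}"
    proof clarify
      fix x y assume "(x, y) \<in> Z"
      then obtain Q where Q: "is_path V R Q" "length Q = ?L" "hd Q = x" "last Q = y" unfolding Z_def by auto
      let ?R = "insert {x, y} R"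
      have Q3: "length Q \<ge> 3" using L3 Q by simp
      then obtain q Q' where Q': "Q = q # Q'" "Q' \<noteq> []" by (cases Q; cases "tl Q") auto
      have xy: "x \<noteq> y" using Q Q' unfolding is_path_def by auto
      have "x \<in> V" "y \<in> V" using Q(1) Q' Q(3,4) unfolding is_path_def by auto
      then have pr: "{x, y} \<in> all_pairs V" using xy unfolding all_pairs_def by auto
      have "?L \<le> longest_path V ?R" using longest_path_mono[OF V(1)] by blast
      moreover have "has_cycle V ?R ?L" unfolding has_cycle_def
        by (rule exI[of _ Q]) (use Q Q3 in \<open>auto simp: is_path_def insert_commute\<close>)
      ultimately have "cycle_potential V R < cycle_potential V ?R"
        using False unfolding cycle_potential_def by (cases "?L = longest_path V ?R") auto
      then show "{x, y} \<in> boosters V R" using pr unfolding boosters_def by auto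
    qed
    obtain P where P: "is_path V R P" "length P = ?L" using longest_path_obtain[OF V(1)] by blast
    let ?T = "last ` rotations R P"
    have P0: "P \<noteq> []" using P L3 by auto
    have sT: "s < card ?T" using many_endpoints[OF V(1,3) e P P0] .
    have fZ: "finite Z" using finite_subset[OF ZB card_pairs_le(2)[OF fB]] .
    have row: "s \<le> card (Z `` {x})" if "x \<in> ?T" for x
    proof -
      obtain Q where Q: "Q \<in> rotations R P" "x = last Q" using \<open>x \<in> ?T\<close> by auto
      note Qp = rotations_path[OF Q(1) P(1)]
      \<comment> \<open>Reversal makes the endpoint \<open>x\<close> the fixed head, so the
        rotations of \<open>rev Q\<close> produce the partners of \<open>x\<close>.\<close>
      have rQ: "is_path V R (rev Q)" "length (rev Q) = ?L" "rev Q \<noteq> []"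
        using Qp P P0 unfolding is_path_def by auto
      have "last ` rotations R (rev Q) \<subseteq> Z `` {x}"
      proof (rule image_subsetI)
        fix W assume W: "W \<in> rotations R (rev Q)"
        have "hd (rev Q) = x" using Q rQ by (simp add: hd_rev)
        then show "last W \<in> Z `` {x}" using rotations_path[OF W rQ(1)] rQ(2) unfolding Z_def by auto
      qed
      moreover have "finite (Z `` {x})" using fZ by (simp add: finite_Image)
      ultimately have "card (last ` rotations R (rev Q)) \<le> card (Z `` {x})" by (intro card_mono)
      then show ?thesis using many_endpoints[OF V(1,3) e rQ] by simp
    qed
    have fT: "finite ?T" using sT by (metis card.infinite not_less0)
    have "s * s \<le> card ?T * s" using sT by (intro mult_right_mono) auto
    also have "\<dots> = (\<Sum>x\<in>?T. s)" by simp
    also have "\<dots> \<le> (\<Sum>x\<in>?T. card (Z `` {x}))" using row by (intro sum_mono) auto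
    also have "\<dots> = card (SIGMA x:?T. Z `` {x})" using fT fZ by (subst card_SigmaI) (auto simp: finite_Image)
    also have "\<dots> \<le> card Z" using fZ by (intro card_mono) auto
    also have "\<dots> \<le> card {(x, y). {x, y} \<in> boosters V R}" by (rule card_mono[OF card_pairs_le(2)[OF fB] ZB])
    also have "\<dots> \<le> 2 * card (boosters V R)" by (rule card_pairs_le(1)[OF fB])
    finally show ?thesis .
  next
    case True
    then obtain P where P: "is_path V R P" "length P = ?L" "{last P, hd P} \<in> R" unfolding has_cycle_def by auto
    define W where "W = set P"
    define U where "U = V - W"
    have WV: "W \<subseteq> V" using P unfolding W_def is_path_def by auto
    have "W \<noteq> V" using cycle_hamilton[OF P(1,3)] nH L3 P(2) unfolding W_def by auto
    then have U0: "U \<noteq> {}" using WV unfolding U_def by auto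
    have longer: "longest_path V (insert {w, z} R) > ?L" if wz: "w \<in> W" "z \<in> U" for w z
    proof -
      have "w \<in> set P" "z \<in> V - set P" using wz unfolding W_def U_def by auto
      from cycle_extend[OF P(1,3) this] obtain Q
        where "is_path V (insert {w, z} R) Q" "length Q = Suc (length P)" .
      then show ?thesis using longest_path_ge[OF V(1)] P(2) by fastforce
    qed
    have noedge: "{w, z} \<notin> R" if "w \<in> W" "z \<in> U" for w z
      using longer[OF that] by (auto simp: insert_absorb)
    have sW: "s < card W" 
    proof (rule ccontr)
      assume "\<not> s < card W"
      moreover have "W \<noteq> {}" using L3 P(2) unfolding W_def by auto
      moreover have "nbhd R W = {}" using noedge nbhd_subset[OF V(3), of W] unfolding nbhd_def U_def by auto
      ultimately show False using expanderD[OF e WV] by simp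
    qed
    have sU: "s < card U"
    proof (rule ccontr)
      assume "\<not> s < card U"
      moreover have "nbhd R U = {}"
        using noedge nbhd_subset[OF V(3), of U] unfolding nbhd_def U_def by (auto simp: insert_commute)
      moreover have "U \<subseteq> V" unfolding U_def by auto
      ultimately show False using expanderD[OF e _ U0] by simp
    qed
    have "(\<lambda>(w, z). {w, z}) ` (W \<times> U) \<subseteq> boosters V R"
    proof clarify
      fix w z assume wz: "w \<in> W" "z \<in> U"
      then have "w \<noteq> z" unfolding U_def by auto
      then have "{w, z} \<in> all_pairs V" using wz WV unfolding U_def all_pairs_def by auto
      moreover have "cycle_potential V R < cycle_potential V (insert {w, z} R)"
        using longer[OF wz] unfolding cycle_potential_def by auto
      ultimately show "{w, z} \<in> boosters V R" unfolding boosters_def by auto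
    qed
    moreover have "inj_on (\<lambda>(w, z). {w, z}) (W \<times> U)"
      unfolding inj_on_def U_def by (auto simp: doubleton_eq_iff)
    ultimately have "card (W \<times> U) \<le> card (boosters V R)" using fB by (metis card_inj_on_le)
    moreover have "s * s \<le> card W * card U" using sW sU by (intro mult_mono) auto
    ultimately show ?thesis by (simp add: card_cartesian_product)
  qed
qed

section \<open>Estimates for the random graph\<close>

lemma card_all_pairs: "finite V \<Longrightarrow> card (all_pairs V) = card V choose 2"
  unfolding all_pairs_def using n_subsets[of V 2] by simp

lemma card_all_pairs_le: "finite V \<Longrightarrow> real (card (all_pairs V)) \<le> (card V)\<^sup>2 / 2"
proof -
  assume V: "finite V"
  have "2 * (card V choose 2) \<le> card V * card V"
    unfolding choose_two by (rule order.trans[OF times_div_less_eq_dividend]) simp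
  then have "2 * real (card V choose 2) \<le> real (card V) * real (card V)"
    by (metis of_nat_le_iff of_nat_mult of_nat_numeral)
  then show ?thesis using V by (simp add: card_all_pairs power2_eq_square)
qed

section \<open>Exponential moments and tail bounds\<close>

lemma prod_two_parts:
  fixes a b :: "'a \<Rightarrow> real"
  assumes "finite P" "R \<subseteq> P" "B \<subseteq> P" "R \<inter> B = {}"
  shows "(\<Prod>e\<in>P. if e \<in> R then a e else if e \<in> B then b e else 1) = prod a R * prod b B"
proof -
  have fin: "finite R" "finite B" using assms by (auto intro: finite_subset)
  have "(\<Prod>e\<in>P. if e \<in> R then a e else if e \<in> B then b e else 1)
      = (\<Prod>e\<in>R \<union> B. if e \<in> R then a e else if e \<in> B then b e else 1)"
    using assms by (intro prod.mono_neutral_right) auto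
  also have "\<dots> = (\<Prod>e\<in>R. if e \<in> R then a e else if e \<in> B then b e else 1)
      * (\<Prod>e\<in>B. if e \<in> R then a e else if e \<in> B then b e else 1)"
    using fin assms by (intro prod.union_disjoint) auto
  also have "(\<Prod>e\<in>R. if e \<in> R then a e else if e \<in> B then b e else 1) = prod a R"
    by (intro prod.cong) auto
  also have "(\<Prod>e\<in>B. if e \<in> R then a e else if e \<in> B then b e else 1) = prod b B"
    using assms(4) by (intro prod.cong) auto
  finally show ?thesis .
qed

lemma prod_if_one: "finite A \<Longrightarrow> (\<Prod>x\<in>A. if P x then z else 1) = (z::real) ^ card {x \<in> A. P x}"
  by (simp add: prod.If_cases Int_def)

text \<open>By independence the expectation factorises over pairs, with factor \<open>p\<close> on
  \<open>R\<close>, \<open>1 - p + p * z\<close> on \<open>B\<close> and 1 elsewhere. Treating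
  \<open>R \<subseteq> E\<close> jointly with the count on \<open>B\<close> preserves the factor
  \<open>p ^ card R\<close> for the later union bound.\<close>

lemma gnp_generating_function:
  assumes p: "0 \<le> p" "p \<le> 1" and z: "0 \<le> z"
    and RB: "R \<subseteq> all_pairs {..<n}" "B \<subseteq> all_pairs {..<n}" "R \<inter> B = {}"
  shows "measure_pmf.expectation (gnp n p) (\<lambda>E. (if R \<subseteq> E then 1 else 0) * z ^ card (E \<inter> B))
     = p ^ card R * (1 - p + p * z) ^ card B"
proof -
  let ?P = "all_pairs {..<n}"
  have fP: "finite ?P" by (rule finite_all_pairs) simp
  have fin: "finite R" "finite B" using RB fP by (auto intro: finite_subset)
  define h where "h e v = (if e \<in> R then (if v then 1 else 0) else if e \<in> B then (if v then z else 1) else 1 :: real)" for e v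
  have eq: "(if R \<subseteq> {e \<in> ?P. f e} then 1 else 0) * z ^ card ({e \<in> ?P. f e} \<inter> B) = (\<Prod>e\<in>?P. h e (f e))" for f
  proof -
    have "(\<Prod>e\<in>?P. h e (f e)) = (\<Prod>e\<in>R. if f e then 1 else 0) * (\<Prod>e\<in>B. if f e then z else 1)"
      unfolding h_def by (rule prod_two_parts[OF fP RB])
    moreover have "{e \<in> B. f e} = {e \<in> ?P. f e} \<inter> B" using RB by auto
    moreover have "(\<Prod>e\<in>R. if f e then 1 else 0 :: real) = (if R \<subseteq> {e \<in> ?P. f e} then 1 else 0)"
    proof (cases "R \<subseteq> {e \<in> ?P. f e}")
      case True
      then show ?thesis by (auto intro!: prod.neutral)
    next
      case False
      then obtain e where "e \<in> R" "\<not> f e" using RB by auto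
      then show ?thesis using False fin by auto
    qed
    ultimately show ?thesis using fin by (simp add: prod_if_one)
  qed
  have "measure_pmf.expectation (gnp n p) (\<lambda>E. (if R \<subseteq> E then 1 else 0) * z ^ card (E \<inter> B))
     = measure_pmf.expectation (Pi_pmf ?P False (\<lambda>_. bernoulli_pmf p)) (\<lambda>f. \<Prod>e\<in>?P. h e (f e))"
    unfolding gnp_def integral_map_pmf eq ..
  also have "\<dots> = (\<Prod>e\<in>?P. measure_pmf.expectation (bernoulli_pmf p) (h e))"
    using fP z by (intro expectation_prod_Pi_pmf) (auto simp: h_def intro: integrable_measure_pmf_finite)
  also have "\<dots> = (\<Prod>e\<in>?P. if e \<in> R then p else if e \<in> B then (1 - p + p * z) else 1)"
    using p by (intro prod.cong refl) (auto simp: h_def)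
  also have "\<dots> = p ^ card R * (1 - p + p * z) ^ card B"
    unfolding prod_two_parts[OF fP RB] by simp
  finally show ?thesis .
qed

lemma set_pmf_gnp: "E \<in> set_pmf (gnp n p) \<Longrightarrow> E \<subseteq> all_pairs {..<n}"
  unfolding gnp_def by auto

lemma finite_set_pmf_gnp: "finite (set_pmf (gnp n p))"
  by (rule finite_subset[of _ "Pow (all_pairs {..<n})"]) (auto dest: set_pmf_gnp simp: finite_all_pairs)

text \<open>The exponential moment method for both tails: \<open>z\<close> below 1 serves lower
  tails, \<open>z\<close> above 1 upper tails, and \<open>C\<close> normalises the moment to be at
  least 1 on the event.\<close>

lemma gnp_markov:
  assumes p: "0 \<le> p" "p \<le> 1" and z: "0 < z"
    and RB: "R \<subseteq> all_pairs {..<n}" "B \<subseteq> all_pairs {..<n}" "R \<inter> B = {}"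
    and ev: "\<And>E. E \<in> A \<Longrightarrow> R \<subseteq> E \<and> 1 \<le> C * z ^ card (E \<inter> B)" and C: "C \<ge> 0"
  shows "measure_pmf.prob (gnp n p) A \<le> C * (p ^ card R * exp (p * card B * (z - 1)))"
proof -
  let ?M = "gnp n p"
  let ?g = "\<lambda>E. C * ((if R \<subseteq> E then 1 else 0) * z ^ card (E \<inter> B))"
  have int: "integrable ?M f" for f :: "nat set set \<Rightarrow> real"
    by (rule integrable_measure_pmf_finite[OF finite_set_pmf_gnp])
  have "measure_pmf.prob ?M A = measure_pmf.expectation ?M (indicator A)" by simp
  also have "\<dots> \<le> measure_pmf.expectation ?M ?g"
    using ev z C by (intro integral_mono int) (auto simp: indicator_def)
  also have "\<dots> = C * (p ^ card R * (1 - p + p * z) ^ card B)"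
    using gnp_generating_function[OF p less_imp_le[OF z] RB] by simp
  also have "(1 - p + p * z) ^ card B \<le> exp (p * (z - 1)) ^ card B"
  proof (rule power_mono)
    show "1 - p + p * z \<le> exp (p * (z - 1))"
      using exp_ge_add_one_self[of "p * (z - 1)"] by (simp add: algebra_simps)
    show "0 \<le> 1 - p + p * z" using p z by simp
  qed
  also have "exp (p * (z - 1)) ^ card B = exp (p * card B * (z - 1))"
    by (simp add: mult_ac flip: exp_of_nat_mult)
  finally show ?thesis using C p by (simp add: mult_left_mono)
qed

text \<open>The choice \<open>z = 1/2\<close> with \<open>C = exp m\<close> works because
  \<open>2 ^ k \<le> exp k\<close>; it keeps half of the mean in the exponent.\<close>

lemma gnp_lower_tail:
  assumes p: "0 \<le> p" "p \<le> 1"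
    and RB: "R \<subseteq> all_pairs {..<n}" "B \<subseteq> all_pairs {..<n}" "R \<inter> B = {}"
  shows "measure_pmf.prob (gnp n p) {E. R \<subseteq> E \<and> real (card (E \<inter> B)) \<le> m}
    \<le> p ^ card R * exp (m - p * card B / 2)"
proof -
  have "measure_pmf.prob (gnp n p) {E. R \<subseteq> E \<and> real (card (E \<inter> B)) \<le> m}
    \<le> exp m * (p ^ card R * exp (p * card B * (1/2 - 1)))"
  proof (rule gnp_markov[OF p _ RB])
    fix E assume E: "E \<in> {E. R \<subseteq> E \<and> real (card (E \<inter> B)) \<le> m}"
    let ?k = "card (E \<inter> B)"
    have "(2::real) ^ ?k \<le> exp 1 ^ ?k" using exp_ge_add_one_self[of 1] by (intro power_mono) auto
    also have "\<dots> = exp ?k" by (simp flip: exp_of_nat_mult)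
    also have "\<dots> \<le> exp m" using E by simp
    finally have "1 \<le> exp m * (1/2) ^ ?k" by (simp add: power_one_over field_simps)
    then show "R \<subseteq> E \<and> 1 \<le> exp m * (1/2) ^ ?k" using E by simp
  qed auto
  also have "\<dots> = p ^ card R * exp (m - p * card B / 2)"
  proof -
    have "exp (m - p * card B / 2) = exp m * exp (p * card B * (1/2 - 1))" by (simp flip: exp_add)
    then show ?thesis by (simp only: mult.left_commute)
  qed
  finally show ?thesis .
qed

lemma gnp_upper_tail:
  assumes p: "0 \<le> p" "p \<le> 1" and B: "B \<subseteq> all_pairs {..<n}" and z: "z \<ge> 1"
  shows "measure_pmf.prob (gnp n p) {E. real (card (E \<inter> B)) \<ge> m} \<le> exp (p * card B * z - m * ln z)"
proof -
  have "measure_pmf.prob (gnp n p) {E. real (card (E \<inter> B)) \<ge> m}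
    \<le> exp (- m * ln z) * (p ^ card ({} :: nat set set) * exp (p * card B * (z - 1)))"
  proof (rule gnp_markov[where R = "{}", OF p _ empty_subsetI B])
    fix E assume E: "E \<in> {E. real (card (E \<inter> B)) \<ge> m}"
    let ?k = "card (E \<inter> B)"
    have "z ^ ?k = exp (?k * ln z)" using z by (simp add: exp_of_nat_mult)
    then have "exp (- m * ln z) * z ^ ?k = exp ((?k - m) * ln z)"
      by (simp add: algebra_simps flip: exp_add)
    also have "\<dots> \<ge> 1" using E z by simp
    finally show "{} \<subseteq> E \<and> 1 \<le> exp (- m * ln z) * z ^ ?k" by simp
  qed (use z in auto)
  also have "\<dots> = exp (p * card B * (z - 1) - m * ln z)"
    by (simp add: algebra_simps flip: exp_add)
  also have "\<dots> \<le> exp (p * card B * z - m * ln z)"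
    using p by (simp add: algebra_simps)
  finally show ?thesis by simp
qed

lemma gnp_union_bound:
  assumes "finite I" "\<And>i. i \<in> I \<Longrightarrow> measure_pmf.prob M (A i) \<le> f i" "S \<subseteq> (\<Union>i\<in>I. A i)"
  shows "measure_pmf.prob M S \<le> sum f I"
proof -
  have "measure_pmf.prob M S \<le> measure_pmf.prob M (\<Union>i\<in>I. A i)"
    using assms(3) by (intro measure_pmf.finite_measure_mono) auto
  also have "\<dots> \<le> (\<Sum>i\<in>I. measure_pmf.prob M (A i))"
    using assms(1) by (intro measure_pmf.finite_measure_subadditive_finite) auto
  also have "\<dots> \<le> sum f I" using assms(2) by (rule sum_mono)
  finally show ?thesis .
qed

section \<open>Typical properties: degrees, sparse small sets, boosters\<close>

definition incident :: "'a set \<Rightarrow> 'a \<Rightarrow> 'a set set" where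
  "incident V v = {e \<in> all_pairs V. v \<in> e}"

lemma card_incident:
  assumes "finite V" "v \<in> V"
  shows "card (incident V v) = card V - 1"
proof -
  have "bij_betw (\<lambda>u. {v, u}) (V - {v}) (incident V v)"
    by (rule bij_betw_imageI)
       (use assms in \<open>auto simp: inj_on_def doubleton_eq_iff incident_def all_pairs_def card_2_iff\<close>)
  then show ?thesis using assms by (metis bij_betw_same_card card_Diff_singleton)
qed

lemma gnp_min_degree:
  assumes p: "0 \<le> p" "p \<le> 1" and n: "n \<ge> 1"
  shows "measure_pmf.prob (gnp n p) {E. \<exists>v<n. real (card (E \<inter> incident {..<n} v)) \<le> n * p / 4}
    \<le> n * exp (1/2 - n * p / 4)"
proof -
  have "measure_pmf.prob (gnp n p) {E. \<exists>v<n. real (card (E \<inter> incident {..<n} v)) \<le> n * p / 4}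
    \<le> (\<Sum>v<n. exp (1/2 - n * p / 4))"
  proof (rule gnp_union_bound[where A = "\<lambda>v. {E. {} \<subseteq> E \<and> real (card (E \<inter> incident {..<n} v)) \<le> n * p / 4}"])
    fix v assume v: "v \<in> {..<n}"
    have "measure_pmf.prob (gnp n p) {E. {} \<subseteq> E \<and> real (card (E \<inter> incident {..<n} v)) \<le> n * p / 4}
      \<le> p ^ card ({} :: nat set set) * exp (n * p / 4 - p * card (incident {..<n} v) / 2)"
      by (intro gnp_lower_tail p) (auto simp: incident_def)
    \<comment> \<open>The gap between \<open>n - 1\<close> and \<open>n\<close> costs
      \<open>p / 2\<close>, which is at most \<open>1/2\<close>.\<close>
    also have "\<dots> \<le> exp (1/2 - n * p / 4)"
      using p n v by (simp add: card_incident of_nat_diff field_simps)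
    finally show "measure_pmf.prob (gnp n p) {E. {} \<subseteq> E \<and> real (card (E \<inter> incident {..<n} v)) \<le> n * p / 4}
      \<le> exp (1/2 - n * p / 4)" .
  qed auto
  then show ?thesis by simp
qed

text \<open>
  The constant \<open>4\<close> matters for small sets only: there \<open>12 * card S\<close> edges inside a set of \<open>3 * card S\<close>
  vertices are already too many, while larger sets are governed by the second term.
\<close>

definition density_bound :: "nat \<Rightarrow> real \<Rightarrow> nat \<Rightarrow> real" where
  "density_bound n p u = u * max 4 (sqrt (u * n) * p)"

lemma sum_half_powers: "(\<Sum>u=1..N. real u * (1/2) ^ u) \<le> 2"
proof -
  have "(\<Sum>u=1..N. real u * (1/2) ^ u) = 2 - (N + 2) * (1/2) ^ N"
    by (induction N) (auto simp: field_simps)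
  then show ?thesis by simp
qed

text \<open>The upper tail at this \<open>z\<close> has exponent at most
  \<open>- u * a * (ln z - 1)\<close>. Since \<open>a \<ge> 4\<close>, this yields a power of
  \<open>exp 4 / z ^ 4\<close>, which is of order \<open>(u / n)\<^sup>2\<close>: one factor
  \<open>u / n\<close> more than the choice of \<open>U\<close> costs.\<close>

lemma gnp_sparse_set:
  assumes p: "0 \<le> p" "p \<le> 1" and n: "n \<ge> 1" and U: "U \<subseteq> {..<n}" "card U = u" "u \<ge> 1" "24 * u \<le> n"
  shows "measure_pmf.prob (gnp n p) {E. real (card (E \<inter> all_pairs U)) \<ge> density_bound n p u}
    \<le> (4 * (u / n)\<^sup>2) ^ u"
proof -
  define a where "a = max 4 (sqrt (u * n) * p)"
  define z where "z = 2 * sqrt (n / u)" \<comment> \<open>makes the mean term \<open>p * u\<^sup>2 / 2 * z\<close> at most \<open>u * a\<close>\<close>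
  have "sqrt 24 \<le> sqrt (n / u)" using U n by (simp add: field_simps flip: of_nat_mult of_nat_le_iff)
  moreover have "(4::real) \<le> sqrt 24" by (rule real_le_rsqrt) auto
  ultimately have z8: "z \<ge> 8" unfolding z_def by linarith
  have e3: "exp 1 \<le> (3::real)" by (rule exp_le)
  have lz: "ln z \<ge> 1"
  proof -
    have "exp 1 \<le> z" using e3 z8 by linarith
    then show ?thesis using z8 by (subst ln_ge_iff) auto
  qed
  have fU: "finite U" using U finite_subset by auto
  have "p * card (all_pairs U) * z \<le> p * ((card U)\<^sup>2 / 2) * z"
    using p z8 card_all_pairs_le[OF fU] by (intro mult_right_mono mult_left_mono) auto
  also have "\<dots> = u * (sqrt (u * n) * p)"
  proof -
    have "u * sqrt (n / u) = sqrt (u * n)"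
      using U by (simp add: real_sqrt_divide real_sqrt_mult field_simps)
    then show ?thesis using U(2) unfolding z_def by (simp add: power2_eq_square mult_ac)
  qed
  also have "\<dots> \<le> u * a" unfolding a_def by (intro mult_left_mono) auto
  finally have "p * card (all_pairs U) * z - (u * a) * ln z \<le> - (u * a * (ln z - 1))"
    by (simp add: algebra_simps)
  also have "\<dots> \<le> - (u * 4 * (ln z - 1))"
    unfolding a_def using lz by (simp add: mult_right_mono mult_left_mono)
  finally have e: "p * card (all_pairs U) * z - (u * a) * ln z \<le> u * (4 - 4 * ln z)"
    by (simp add: algebra_simps)
  have "z\<^sup>2 = 4 * (n / u)" unfolding z_def by (simp add: power_mult_distrib)
  then have z4: "z ^ 4 = (4 * (n / u))\<^sup>2"
    by (metis power_mult mult_2_right numeral_Bit0)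
  \<comment> \<open>With \<open>z ^ 4 = 16 * (n / u)\<^sup>2\<close>, the constant 4 of the
    conclusion needs \<open>exp 4 \<le> 64\<close>; bounding \<open>exp 1\<close> by 3 would give
    81.\<close>
  have "exp 4 = (exp 1 :: real) ^ 4" by (simp flip: exp_of_nat_mult)
  also have "\<dots> \<le> (2.72::real) ^ 4" using e_less_272 by (intro power_mono) auto
  also have "\<dots> \<le> 64" by (simp add: power_numeral_reduce)
  finally have e4: "exp 4 \<le> (64::real)" .
  have "exp (4 - 4 * ln z) = exp 4 / z ^ 4"
    using z8 exp_of_nat_mult[of 4 "ln z"] by (simp add: exp_diff)
  also have "\<dots> \<le> 64 / (4 * (n / u))\<^sup>2" unfolding z4 using e4 by (intro divide_right_mono) auto
  also have "\<dots> = 4 * (u / n)\<^sup>2" using U n by (simp add: field_simps power2_eq_square)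
  finally have f: "exp (4 - 4 * ln z) \<le> 4 * (u / n)\<^sup>2" .
  have "measure_pmf.prob (gnp n p) {E. real (card (E \<inter> all_pairs U)) \<ge> u * a}
    \<le> exp (p * card (all_pairs U) * z - (u * a) * ln z)"
    using U z8 by (intro gnp_upper_tail p) (auto simp: all_pairs_def)
  also have "\<dots> \<le> exp (u * (4 - 4 * ln z))" using e by simp
  also have "\<dots> = (exp (4 - 4 * ln z)) ^ u" by (rule exp_of_nat_mult)
  also have "\<dots> \<le> (4 * (u / n)\<^sup>2) ^ u" using f by (rule power_mono) simp
  finally show ?thesis unfolding a_def density_bound_def by (simp only: of_nat_mult)
qed

text \<open>The left side is a single term of the expansion of \<open>(1 + x) ^ n\<close>. With
  \<open>x = u / n\<close> this is the usual bound of a binomial coefficient by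
  \<open>(exp 1 * n / u) ^ u\<close>.\<close>

lemma binomial_times_power_le:
  assumes "x \<ge> 0"
  shows "real (n choose u) * x ^ u \<le> exp (n * x)"
proof (cases "u \<le> n")
  case True
  have "real (n choose u) * x ^ u \<le> (\<Sum>k\<le>n. real (n choose k) * x ^ k)"
    using True assms by (intro member_le_sum) auto
  also have "\<dots> = (x + 1) ^ n" using binomial_ring[of x 1 n] by simp
  also have "\<dots> \<le> exp x ^ n" using assms exp_ge_add_one_self[of x] by (intro power_mono) (auto simp: add.commute)
  also have "\<dots> = exp (n * x)" by (simp flip: exp_of_nat_mult)
  finally show ?thesis .
qed (simp add: binomial_eq_0)

lemma gnp_sparse_sets:
  fixes \<theta> :: real
  assumes p: "0 \<le> p" "p \<le> 1" and n: "n \<ge> 1" and \<theta>: "\<theta> \<le> 1/24"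
  shows "measure_pmf.prob (gnp n p) {E. \<exists>U\<subseteq>{..<n}. U \<noteq> {} \<and> card U \<le> \<theta> * n
      \<and> real (card (E \<inter> all_pairs U)) \<ge> density_bound n p (card U)} \<le> 48 / n"
    (is "measure_pmf.prob _ ?A \<le> _")
proof -
  define N where "N = nat \<lfloor>\<theta> * n\<rfloor>"
  have N: "24 * u \<le> n" if "u \<in> {1..N}" for u
  proof -
    have "real u \<le> \<theta> * n" using that unfolding N_def by (simp add: le_nat_floor) linarith
    also have "\<dots> \<le> 1/24 * n" using \<theta> by (intro mult_right_mono) auto
    finally show ?thesis by simp
  qed
  have "measure_pmf.prob (gnp n p) ?A \<le> (\<Sum>u=1..N. 24 / n * (u * (1/2) ^ u))"
  proof (rule gnp_union_bound[where A = "\<lambda>u. \<Union>U\<in>{U. U \<subseteq> {..<n} \<and> card U = u}.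
      {E. real (card (E \<inter> all_pairs U)) \<ge> density_bound n p u}"])
    fix u assume u: "u \<in> {1..N}"
    have "measure_pmf.prob (gnp n p) (\<Union>U\<in>{U. U \<subseteq> {..<n} \<and> card U = u}.
        {E. real (card (E \<inter> all_pairs U)) \<ge> density_bound n p u})
      \<le> (\<Sum>U\<in>{U. U \<subseteq> {..<n} \<and> card U = u}. (4 * (u / n)\<^sup>2) ^ u)"
      using gnp_sparse_set[OF p n] u N by (intro gnp_union_bound[where A = "\<lambda>U. {E. real (card (E \<inter> all_pairs U)) \<ge> density_bound n p u}"]) auto
    also have "\<dots> = real (n choose u) * (4 * (u / n)\<^sup>2) ^ u" by (simp add: n_subsets)
    also have "\<dots> = (real (n choose u) * (u / n) ^ u) * (4 * (u / n)) ^ u"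
    proof -
      have "(4 * (u / n)\<^sup>2) ^ u = (u / n) ^ u * (4 * (u / n)) ^ u"
        by (subst power_mult_distrib[symmetric]) (simp add: power2_eq_square mult_ac)
      then show ?thesis by (simp only: mult.assoc)
    qed
    also have "\<dots> \<le> exp (n * (real u / n)) * (4 * (u / n)) ^ u"
      by (intro mult_right_mono binomial_times_power_le) auto
    also have "\<dots> = (exp 1 * (4 * (u / n))) ^ u"
    proof -
      have "exp (n * (real u / n)) = exp 1 ^ u" using n by (simp flip: exp_of_nat_mult)
      then show ?thesis by (simp only: power_mult_distrib)
    qed
    also have "\<dots> \<le> (3 * (4 * (u / n))) ^ u" by (intro power_mono mult_right_mono exp_le) auto
    also have "\<dots> = (12 * (u / n)) ^ u" by simp
    \<comment> \<open>One factor is set aside to supply \<open>1 / n\<close>; the remaining ones are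
      at most \<open>1/2\<close> because \<open>24 * u \<le> n\<close>, which leaves a convergent
      sum.\<close>
    also have "\<dots> = (12 * (u / n)) * (12 * (u / n)) ^ (u - 1)" using u by (cases u) auto
    also have "\<dots> \<le> (12 * (u / n)) * (1/2) ^ (u - 1)"
      using N[OF u] n by (intro mult_left_mono power_mono) (auto simp: field_simps)
    also have "\<dots> = 24 / n * (u * (1/2) ^ u)" using u by (cases u) auto
    finally show "measure_pmf.prob (gnp n p) (\<Union>U\<in>{U. U \<subseteq> {..<n} \<and> card U = u}.
        {E. real (card (E \<inter> all_pairs U)) \<ge> density_bound n p u}) \<le> 24 / n * (u * (1/2) ^ u)" .
  next
    show "?A \<subseteq> (\<Union>u\<in>{1..N}. \<Union>U\<in>{U. U \<subseteq> {..<n} \<and> card U = u}.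
      {E. real (card (E \<inter> all_pairs U)) \<ge> density_bound n p u})"
    proof clarify
      fix E :: "nat set set" and U :: "nat set"
      assume U: "U \<subseteq> {..<n}" "U \<noteq> {}" "card U \<le> \<theta> * n"
        and d: "real (card (E \<inter> all_pairs U)) \<ge> density_bound n p (card U)"
      have "finite U" using U finite_subset by auto
      then have "card U \<in> {1..N}" using U(2,3) unfolding N_def
        by (simp add: Suc_le_eq card_gt_0_iff le_nat_floor)
      then show "E \<in> (\<Union>u\<in>{1..N}. \<Union>U\<in>{U. U \<subseteq> {..<n} \<and> card U = u}.
        {E. real (card (E \<inter> all_pairs U)) \<ge> density_bound n p u})" using U d by blast
    qed
  qed auto
  also have "\<dots> = 24 / n * (\<Sum>u=1..N. u * (1/2) ^ u)" by (simp add: sum_distrib_left)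
  also have "\<dots> \<le> 24 / n * 2" by (intro mult_left_mono sum_half_powers) auto
  finally show ?thesis by simp
qed

lemma sum_powers_subsets:
  fixes x :: real
  assumes "finite P"
  shows "(\<Sum>R\<in>Pow P. x ^ card R) = (1 + x) ^ card P"
  using prod_add[OF assms, of "\<lambda>_. x" "\<lambda>_. 1"] by (simp add: add.commute)

text \<open>
  The union bound over \<open>R\<close> weights each \<open>R\<close> by \<open>(c / 5) ^ card R\<close>; this costs only \<open>(5 / c) ^ (K * n)\<close>
  as \<open>card R \<le> K * n\<close>, and it replaces any estimate on the number of sets \<open>R\<close> of a given size.
\<close>

lemma gnp_many_edges_in:
  fixes B :: "nat set set \<Rightarrow> nat set set"
  assumes p: "0 \<le> p" "p \<le> 1" and c: "0 < c" "c \<le> 1"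
    and F: "\<And>R. R \<in> F \<Longrightarrow> R \<subseteq> all_pairs {..<n} \<and> card R \<le> K * n"
    and B: "\<And>R. R \<in> F \<Longrightarrow> B R \<subseteq> all_pairs {..<n} \<and> R \<inter> B R = {} \<and> real (card (B R)) \<ge> c * n\<^sup>2"
  shows "measure_pmf.prob (gnp n p) {E. \<exists>R\<in>F. R \<subseteq> E \<and> real (card (E \<inter> B R)) \<le> c * n\<^sup>2 * p / 4}
    \<le> exp (K * n * ln (5 / c) - 3/20 * c * n\<^sup>2 * p)"
proof -
  let ?P = "all_pairs {..<n}"
  have fP: "finite ?P" by (rule finite_all_pairs) simp
  have FP: "F \<subseteq> Pow ?P" using F by auto
  then have fF: "finite F" using fP finite_subset by auto
  \<comment> \<open>Summing \<open>(p * w) ^ card R\<close> over all \<open>R\<close> then costs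
    \<open>exp (c * n\<^sup>2 * p / 10)\<close>, while \<open>?D\<close> gains
    \<open>c * n\<^sup>2 * p / 4\<close> in the exponent; the difference is the factor
    \<open>3/20\<close>.\<close>
  define w where "w = c / 5"
  have w: "0 < w" "w \<le> 1" using c unfolding w_def by auto
  let ?D = "exp (c * n\<^sup>2 * p / 4 - p * (c * n\<^sup>2) / 2)"
  let ?W = "(1 / w) ^ (K * n)"
  have "(\<Sum>R\<in>Pow ?P. (p * w) ^ card R) = (1 + p * w) ^ card ?P" by (rule sum_powers_subsets[OF fP])
  also have "\<dots> \<le> exp (p * w) ^ card ?P" using p w by (intro power_mono) auto
  also have "\<dots> = exp (p * w * card ?P)" by (simp add: mult_ac flip: exp_of_nat_mult)
  also have "\<dots> \<le> exp (p * w * (n\<^sup>2 / 2))"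
  proof -
    have "p * w * card ?P \<le> p * w * (n\<^sup>2 / 2)"
      using card_all_pairs_le[of "{..<n}"] p w by (intro mult_left_mono) auto
    then show ?thesis by simp
  qed
  finally have S: "(\<Sum>R\<in>Pow ?P. (p * w) ^ card R) \<le> exp (p * w * (n\<^sup>2 / 2))" .
  have "measure_pmf.prob (gnp n p) {E. \<exists>R\<in>F. R \<subseteq> E \<and> real (card (E \<inter> B R)) \<le> c * n\<^sup>2 * p / 4}
    \<le> (\<Sum>R\<in>F. ?W * ?D * (p * w) ^ card R)"
  proof (rule gnp_union_bound[where A = "\<lambda>R. {E. R \<subseteq> E \<and> real (card (E \<inter> B R)) \<le> c * n\<^sup>2 * p / 4}"])
    fix R assume R: "R \<in> F"
    have "measure_pmf.prob (gnp n p) {E. R \<subseteq> E \<and> real (card (E \<inter> B R)) \<le> c * n\<^sup>2 * p / 4}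
      \<le> p ^ card R * exp (c * n\<^sup>2 * p / 4 - p * card (B R) / 2)"
      using F[OF R] B[OF R] by (intro gnp_lower_tail p) auto
    also have "\<dots> \<le> p ^ card R * ?D"
    proof -
      have "p * (c * n\<^sup>2) \<le> p * card (B R)" using B[OF R] p by (intro mult_left_mono) auto
      then show ?thesis using p by (intro mult_left_mono) (auto simp: mult_ac)
    qed
    also have "\<dots> \<le> (?W * (p * w) ^ card R) * ?D"
    proof (rule mult_right_mono)
      have "p ^ card R = (1 / w) ^ card R * (p * w) ^ card R"
        using w by (simp add: power_mult_distrib power_divide)
      also have "\<dots> \<le> ?W * (p * w) ^ card R"
        using F[OF R] w p by (intro mult_right_mono power_increasing) auto
      finally show "p ^ card R \<le> ?W * (p * w) ^ card R" .
    qed simp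
    finally show "measure_pmf.prob (gnp n p) {E. R \<subseteq> E \<and> real (card (E \<inter> B R)) \<le> c * n\<^sup>2 * p / 4}
      \<le> ?W * ?D * (p * w) ^ card R" by (simp only: mult_ac)
  qed (use fF in auto)
  also have "\<dots> = ?W * ?D * (\<Sum>R\<in>F. (p * w) ^ card R)" by (simp only: sum_distrib_left)
  also have "\<dots> \<le> ?W * ?D * (\<Sum>R\<in>Pow ?P. (p * w) ^ card R)"
    using FP fP p w by (intro mult_left_mono sum_mono2) auto
  also have "\<dots> \<le> ?W * ?D * exp (p * w * (n\<^sup>2 / 2))" using S w by (intro mult_left_mono) auto
  also have "\<dots> = exp (K * n * ln (5 / c) - 3/20 * c * n\<^sup>2 * p)"
  proof -
    have "?W = exp (K * n * ln (5 / c))"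
      using c unfolding w_def by (simp add: exp_of_nat_mult flip: of_nat_mult)
    then show ?thesis unfolding w_def by (simp add: algebra_simps flip: exp_add)
  qed
  finally show ?thesis by (simp only: of_nat_mult of_nat_power)
qed

section \<open>Rainbow expanders\<close>

text \<open>The inequality of arithmetic and geometric means, from
  \<open>y \<le> exp (y - 1)\<close> at \<open>y = x j / t\<close>.\<close>

lemma prod_le_power_mean:
  fixes x :: "'a \<Rightarrow> real" and t :: real
  assumes "finite J" "t > 0" "\<And>j. j \<in> J \<Longrightarrow> x j \<ge> 0" "sum x J \<le> t * card J"
  shows "prod x J \<le> t ^ card J"
proof -
  have "prod x J = (\<Prod>j\<in>J. t * (x j / t))" using assms(2) by simp
  also have "\<dots> = t ^ card J * (\<Prod>j\<in>J. x j / t)" by (subst prod.distrib) simp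
  also have "(\<Prod>j\<in>J. x j / t) \<le> (\<Prod>j\<in>J. exp (x j / t - 1))"
  proof (rule prod_mono)
    fix j assume "j \<in> J"
    then show "0 \<le> x j / t \<and> x j / t \<le> exp (x j / t - 1)"
      using assms exp_ge_add_one_self[of "x j / t - 1"] by simp
  qed
  also have "\<dots> = exp (sum x J / t - card J)"
    using assms(1) by (simp add: exp_sum[symmetric] sum_subtractf sum_divide_distrib)
  also have "\<dots> \<le> 1" using assms by (simp add: field_simps)
  finally show ?thesis using assms(2) by (simp add: mult_left_le)
qed

lemma sum_card_incident_le:
  assumes "finite F" "\<And>e. e \<in> F \<Longrightarrow> card e = 2" "finite S"
  shows "(\<Sum>v\<in>S. card {e \<in> F. v \<in> e}) \<le> 2 * card F"
proof -
  have "(\<Sum>v\<in>S. card {e \<in> F. v \<in> e}) = (\<Sum>v\<in>S. \<Sum>e\<in>F. if v \<in> e then 1 else 0)"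
    using assms(1) by (intro sum.cong refl) (simp add: sum.If_cases Int_def)
  also have "\<dots> = (\<Sum>e\<in>F. \<Sum>v\<in>S. if v \<in> e then 1 else 0)" by (rule sum.swap)
  also have "\<dots> = (\<Sum>e\<in>F. card (S \<inter> e))"
    using assms(3) by (intro sum.cong refl) (simp add: sum.If_cases Int_def)
  also have "\<dots> \<le> (\<Sum>e\<in>F. 2)"
  proof (rule sum_mono)
    fix e assume "e \<in> F"
    then have "card e = 2" using assms by simp
    then have "finite e" by (metis card.infinite zero_neq_numeral)
    then show "card (S \<inter> e) \<le> 2" using card_mono[of e "S \<inter> e"] \<open>card e = 2\<close> by auto
  qed
  finally show ?thesis by simp
qed

section \<open>The two kinds of bad events and their weights\<close>

definition mono_picks :: "('e \<Rightarrow> 'c) \<Rightarrow> ('i \<Rightarrow> 'e set) \<Rightarrow> 'i \<Rightarrow> 'i \<Rightarrow> ('i \<Rightarrow> 'e) set" where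
  "mono_picks c A x y = {g \<in> PiE {x, y} A. c (g x) = c (g y)}"

lemma mono_picks_commute: "mono_picks c A x y = mono_picks c A y x"
  unfolding mono_picks_def by (auto simp: insert_commute)

lemma card_mono_picks:
  assumes "finite (A x)" "finite (A y)"
  shows "finite (mono_picks c A x y)"
    and "card (mono_picks c A x y) \<le> (\<Sum>e\<in>A x. card {e' \<in> A y. c e' = c e})"
proof -
  let ?S = "SIGMA e:A x. {e' \<in> A y. c e' = c e}"
  have inj: "inj_on (\<lambda>g. (g x, g y)) (mono_picks c A x y)"
    unfolding mono_picks_def
    by (intro inj_onI PiE_ext[where k = "{x, y}"]) auto
  have sub: "(\<lambda>g. (g x, g y)) ` mono_picks c A x y \<subseteq> ?S" unfolding mono_picks_def by auto
  have fin: "finite ?S" using assms by auto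
  show "finite (mono_picks c A x y)" using inj_on_finite[OF inj sub fin] .
  have "card (mono_picks c A x y) \<le> card ?S" using card_inj_on_le[OF inj sub fin] .
  also have "\<dots> = (\<Sum>e\<in>A x. card {e' \<in> A y. c e' = c e})" using assms by (subst card_SigmaI) auto
  finally show "card (mono_picks c A x y) \<le> (\<Sum>e\<in>A x. card {e' \<in> A y. c e' = c e})" .
qed

text \<open>For a fixed edge in \<open>A v\<close>, at most \<Delta> edges share its colour; each of
  them is available at no more than two vertices and in \<open>k\<close> slots per vertex.\<close>

lemma sum_card_mono_picks:
  fixes A :: "'v \<Rightarrow> 'v set set" and \<Delta> :: real and k :: nat
  assumes V: "finite V" and E: "finite E" "E \<subseteq> all_pairs V" and A: "\<And>v. v \<in> V \<Longrightarrow> A v \<subseteq> {e \<in> E. v \<in> e}"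
    and c: "globally_bounded E c \<Delta>" and v: "v \<in> V"
  shows "(\<Sum>y\<in>V \<times> {..<k}. real (card (mono_picks c (\<lambda>(v, i). A v) (v, i) y))) \<le> card (A v) * (2 * k * \<Delta>)"
proof -
  let ?I = "V \<times> {..<k}" and ?A = "\<lambda>(v, i). A v"
  have fA: "finite (A v)" if "v \<in> V" for v using A[OF that] E finite_subset by fastforce
  have each: "(\<Sum>y\<in>?I. real (card {e' \<in> ?A y. c e' = a})) \<le> 2 * k * \<Delta>" for a
  proof -
    let ?F = "{e \<in> E. c e = a}"
    have "(\<Sum>v\<in>V. card {e' \<in> A v. c e' = a}) \<le> (\<Sum>v\<in>V. card {e \<in> ?F. v \<in> e})"
      using A E by (intro sum_mono card_mono) auto
    also have "\<dots> \<le> 2 * card ?F"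
      using E V by (intro sum_card_incident_le) (auto simp: all_pairs_def)
    finally have 1: "(\<Sum>v\<in>V. card {e' \<in> A v. c e' = a}) \<le> 2 * card ?F" .
    have "(\<Sum>y\<in>?I. card {e' \<in> ?A y. c e' = a}) = (\<Sum>v\<in>V. \<Sum>i<k. card {e' \<in> A v. c e' = a})"
      by (simp only: sum.cartesian_product) (simp add: case_prod_unfold)
    also have "\<dots> = k * (\<Sum>v\<in>V. card {e' \<in> A v. c e' = a})" by (simp add: sum_distrib_left)
    also have "\<dots> \<le> k * (2 * card ?F)" using 1 by (rule mult_left_mono) simp
    finally have "real (\<Sum>y\<in>?I. card {e' \<in> ?A y. c e' = a}) \<le> real (k * (2 * card ?F))"
      by (simp only: of_nat_le_iff)
    also have "\<dots> = 2 * k * real (card ?F)" by simp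
    also have "\<dots> \<le> 2 * k * \<Delta>" using c unfolding globally_bounded_def by (intro mult_left_mono) auto
    finally show ?thesis by simp
  qed
  have "(\<Sum>y\<in>?I. real (card (mono_picks c ?A (v, i) y)))
    \<le> (\<Sum>y\<in>?I. \<Sum>e\<in>A v. real (card {e' \<in> ?A y. c e' = c e}))"
  proof (rule sum_mono)
    fix y assume "y \<in> ?I"
    then have "card (mono_picks c ?A (v, i) y) \<le> (\<Sum>e\<in>?A (v, i). card {e' \<in> ?A y. c e' = c e})"
      using fA v by (intro card_mono_picks(2)) auto
    then have "real (card (mono_picks c ?A (v, i) y)) \<le> real (\<Sum>e\<in>A v. card {e' \<in> ?A y. c e' = c e})"
      by (simp only: of_nat_le_iff split)
    then show "real (card (mono_picks c ?A (v, i) y)) \<le> (\<Sum>e\<in>A v. real (card {e' \<in> ?A y. c e' = c e}))"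
      by simp
  qed
  also have "\<dots> = (\<Sum>e\<in>A v. \<Sum>y\<in>?I. real (card {e' \<in> ?A y. c e' = c e}))" by (rule sum.swap)
  also have "\<dots> \<le> (\<Sum>e\<in>A v. 2 * k * \<Delta>)" by (intro sum_mono each)
  finally show ?thesis by simp
qed

definition inner_picks :: "('v \<Rightarrow> 'v set set) \<Rightarrow> 'v set \<Rightarrow> 'v set \<Rightarrow> ('v \<times> nat \<Rightarrow> 'v set) set" where
  "inner_picks A S T = PiE (S \<times> {..<12}) (\<lambda>(v, i). A v \<inter> all_pairs T)"

text \<open>The count is a product of degrees into \<open>T\<close>, each taken twelve times. These
  degrees sum over \<open>S\<close> to at most twice the number of edges inside \<open>T\<close>, so
  their mean is at most \<open>t\<close>, and the product is largest when all are equal.\<close>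

lemma card_inner_picks:
  fixes t :: real
  assumes V: "finite T" "S \<subseteq> T" and E: "finite E" and A: "\<And>v. v \<in> S \<Longrightarrow> A v \<subseteq> {e \<in> E. v \<in> e}"
    and t: "t > 0" "real (card (E \<inter> all_pairs T)) \<le> t * card S / 2"
  shows "finite (inner_picks A S T)" and "real (card (inner_picks A S T)) \<le> t ^ (12 * card S)"
proof -
  have fS: "finite S" using V finite_subset by auto
  have fA: "finite (A v)" if "v \<in> S" for v using A[OF that] E finite_subset by fastforce
  show "finite (inner_picks A S T)" unfolding inner_picks_def using fS fA by (intro finite_PiE) auto
  let ?J = "S \<times> {..<12::nat}"
  have "(\<Sum>v\<in>S. card (A v \<inter> all_pairs T)) \<le> (\<Sum>v\<in>S. card {e \<in> E \<inter> all_pairs T. v \<in> e})"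
    using A E by (intro sum_mono card_mono) auto
  also have "\<dots> \<le> 2 * card (E \<inter> all_pairs T)"
    using E fS by (intro sum_card_incident_le) (auto simp: all_pairs_def)
  finally have "real (\<Sum>v\<in>S. card (A v \<inter> all_pairs T)) \<le> real (2 * card (E \<inter> all_pairs T))"
    by (simp only: of_nat_le_iff)
  then have 1: "(\<Sum>v\<in>S. real (card (A v \<inter> all_pairs T))) \<le> t * card S" using t by simp
  have "real (card (inner_picks A S T)) = (\<Prod>j\<in>?J. real (card (A (fst j) \<inter> all_pairs T)))"
    unfolding inner_picks_def using fS by (simp add: card_PiE case_prod_unfold)
  also have "\<dots> \<le> t ^ card ?J"
  proof (rule prod_le_power_mean)
    have "(\<Sum>j\<in>?J. real (card (A (fst j) \<inter> all_pairs T))) = (\<Sum>v\<in>S. \<Sum>i<12::nat. real (card (A v \<inter> all_pairs T)))"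
      by (simp only: sum.cartesian_product) (simp add: case_prod_unfold)
    also have "\<dots> = 12 * (\<Sum>v\<in>S. real (card (A v \<inter> all_pairs T)))" by (simp add: sum_distrib_left)
    also have "\<dots> \<le> t * card ?J" using 1 by (simp add: card_cartesian_product)
    finally show "(\<Sum>j\<in>?J. real (card (A (fst j) \<inter> all_pairs T))) \<le> t * card ?J" .
  qed (use fS t in auto)
  finally show "real (card (inner_picks A S T)) \<le> t ^ (12 * card S)"
    by (simp add: card_cartesian_product mult.commute)
qed

text \<open>After \<open>T\<close> is chosen, \<open>S\<close> is one of its
  \<open>2 ^ (3 * u) = 8 ^ u\<close> subsets.\<close>

lemma sum_over_set_pairs:
  fixes h :: "nat \<Rightarrow> real"
  assumes V: "finite V" and h: "\<And>u. h u \<ge> 0"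
    and X: "X \<subseteq> {(S, T). S \<subseteq> T \<and> T \<subseteq> V \<and> card T = 3 * card S \<and> card S \<in> {1..s}}"
  shows "(\<Sum>(S, T)\<in>X. h (card S)) \<le> (\<Sum>u=1..s. real (card V choose (3 * u)) * 8 ^ u * h u)"
proof -
  have fX: "finite X"
    by (rule finite_subset[of _ "Pow V \<times> Pow V"]) (use X V in auto)
  have "(\<Sum>(S, T)\<in>X. h (card S)) = (\<Sum>q\<in>X. h (card (fst q)))" by (simp add: case_prod_unfold)
  also have "\<dots> = (\<Sum>u\<in>{1..s}. \<Sum>q\<in>{q \<in> X. card (fst q) = u}. h (card (fst q)))"
    using fX X by (intro sum.group[symmetric]) auto
  also have "\<dots> \<le> (\<Sum>u=1..s. real (card V choose (3 * u)) * 8 ^ u * h u)"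
  proof (rule sum_mono)
    fix u assume u: "u \<in> {1..s}"
    let ?Y = "SIGMA T:{T. T \<subseteq> V \<and> card T = 3 * u}. Pow T"
    have fin: "finite ?Y" using V by (auto intro!: finite_SigmaI intro: finite_subset)
    have "card ?Y = (\<Sum>T\<in>{T. T \<subseteq> V \<and> card T = 3 * u}. card (Pow T))"
      using V by (subst card_SigmaI) (auto intro: finite_subset)
    also have "\<dots> = (\<Sum>T\<in>{T. T \<subseteq> V \<and> card T = 3 * u}. 8 ^ u)"
    proof (rule sum.cong)
      fix T assume "T \<in> {T. T \<subseteq> V \<and> card T = 3 * u}"
      then have "card (Pow T) = 2 ^ (3 * u)" using V by (subst card_Pow) (auto intro: finite_subset)
      then show "card (Pow T) = 8 ^ u" by (simp add: power_mult)
    qed simp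
    also have "\<dots> = (card V choose (3 * u)) * 8 ^ u" using n_subsets[OF V] by simp
    finally have cY: "card ?Y = (card V choose (3 * u)) * 8 ^ u" .
    have "card {q \<in> X. card (fst q) = u} \<le> card ?Y"
    proof (rule card_inj_on_le[OF _ _ fin])
      show "inj_on (\<lambda>(S, T). (T, S)) {q \<in> X. card (fst q) = u}" by (auto simp: inj_on_def)
      show "(\<lambda>(S, T). (T, S)) ` {q \<in> X. card (fst q) = u} \<subseteq> ?Y" using X by auto
    qed
    then have "real (card {q \<in> X. card (fst q) = u}) * h u \<le> real (card ?Y) * h u"
      using h by (intro mult_right_mono) auto
    then show "(\<Sum>q\<in>{q \<in> X. card (fst q) = u}. h (card (fst q))) \<le> real (card V choose (3 * u)) * 8 ^ u * h u"
      unfolding cY by simp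
  qed
  finally show ?thesis .
qed

lemma sum_quarter_powers: "(\<Sum>u=1..s. (1/4) ^ u) \<le> (1/2 :: real)"
proof -
  have "(\<Sum>u=1..s. (1/4) ^ u) = 1/3 - 1/3 * (1/4 :: real) ^ s" by (induction s) auto
  moreover have "(1/4 :: real) ^ s \<ge> 0" by simp
  ultimately show ?thesis by linarith
qed

text \<open>With \<open>x = 3 * u / n\<close>, twelve picks turn the square root into
  \<open>x ^ (6 * u)\<close>. Half of this power pays for the choice of \<open>T\<close>; the other
  half outweighs \<open>8 ^ u\<close> and the powers of 48.\<close>

lemma inner_pick_weights:
  fixes n :: nat
  assumes n: "n \<ge> 1" and s: "3 * s \<le> n / 10 ^ 8"
  shows "(\<Sum>u=1..s. real (n choose (3 * u)) * 8 ^ u * (48 * sqrt (3 * real u / n)) ^ (12 * u)) \<le> 1/2"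
proof -
  have "real (n choose (3 * u)) * 8 ^ u * (48 * sqrt (3 * real u / n)) ^ (12 * u) \<le> (1/4) ^ u" if u: "u \<in> {1..s}" for u
  proof -
    define x where "x = 3 * real u / n"
    have x: "0 \<le> x" "x \<le> 1 / 10 ^ 8" using u s n unfolding x_def by (auto simp: field_simps)
    have nx: "n * x = 3 * u" using n unfolding x_def by simp
    have "sqrt x ^ 12 = x ^ 6"
      using x(1) power_mult[of "sqrt x" 2 6] by simp
    then have "(48 * sqrt x) ^ (12 * u) = (48 ^ 12 * x ^ 6) ^ u"
      by (simp only: power_mult power_mult_distrib)
    also have "\<dots> = x ^ (3 * u) * (48 ^ 12 * x ^ 3) ^ u"
    proof -
      have "48 ^ 12 * x ^ 6 = x ^ 3 * (48 ^ 12 * x ^ 3)" by (simp add: power_numeral_reduce)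
      then show ?thesis by (simp only: power_mult_distrib power_mult)
    qed
    finally have "real (n choose (3 * u)) * 8 ^ u * (48 * sqrt x) ^ (12 * u)
      = (real (n choose (3 * u)) * x ^ (3 * u)) * (8 ^ u * (48 ^ 12 * x ^ 3) ^ u)" by (simp only: mult_ac)
    also have "\<dots> \<le> exp (n * x) * (8 ^ u * (48 ^ 12 * x ^ 3) ^ u)"
      using x by (intro mult_right_mono binomial_times_power_le) auto
    also have "exp (n * x) = (exp 1 ^ 3) ^ u"
      unfolding nx by (simp flip: exp_of_nat_mult power_mult)
    also have "(exp 1 ^ 3) ^ u * (8 ^ u * (48 ^ 12 * x ^ 3) ^ u) = (exp 1 ^ 3 * (8 * (48 ^ 12 * x ^ 3))) ^ u"
      by (simp only: power_mult_distrib)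
    \<comment> \<open>The size restriction \<open>10 ^ 8\<close> makes this base about 0.03.\<close>
    also have "\<dots> \<le> (3 ^ 3 * (8 * (48 ^ 12 * (1 / 10 ^ 8) ^ 3))) ^ u"
      using x by (intro power_mono mult_mono exp_le) auto
    also have "\<dots> \<le> (1/4) ^ u" by (intro power_mono) (auto simp: power_divide)
    finally show ?thesis unfolding x_def by simp
  qed
  then have "(\<Sum>u=1..s. real (n choose (3 * u)) * 8 ^ u * (48 * sqrt (3 * real u / n)) ^ (12 * u)) \<le> (\<Sum>u=1..s. (1/4) ^ u)"
    by (rule sum_mono)
  then show ?thesis using sum_quarter_powers[of s] by linarith
qed

text \<open>Each of the twelve slots of a vertex has \<open>d\<close> choices. Taking \<beta> as
  half of \<open>d\<close> leaves \<beta> for the weights of the bad events, shared equally between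
  repeated colours and failures of expansion.\<close>

lemma rainbow_expander:
  fixes n :: nat and p :: real and c :: "nat set \<Rightarrow> 'c"
  defines "V \<equiv> {..<n}"
  assumes n: "n \<ge> 1" and p: "0 < p"
    and E: "E \<subseteq> all_pairs V"
    and deg: "\<And>v. v \<in> V \<Longrightarrow> real (card (E \<inter> incident V v)) \<ge> n * p / 4"
    and dens: "\<And>U. U \<subseteq> V \<Longrightarrow> U \<noteq> {} \<Longrightarrow> card U \<le> n / 10 ^ 8 \<Longrightarrow>
        real (card (E \<inter> all_pairs U)) < density_bound n p (card U)"
    and s: "3 * s \<le> n / 10 ^ 8"
    and c: "globally_bounded E c (n * p / 768)"
  obtains R where "R \<subseteq> E" "inj_on c R" "card R \<le> 12 * n" "expander V R s"
proof -
  have fV: "finite V" and cV: "card V = n" unfolding V_def by auto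
  have fE: "finite E" using E finite_all_pairs[OF fV] finite_subset by auto
  define d where "d = nat \<lceil>n * p / 4\<rceil>"
  define \<beta> where "\<beta> = real d / 2"
  have d: "real d \<ge> n * p / 4" unfolding d_def using p by (simp add: of_nat_ceiling)
  have np: "n * p > 0" using n p by simp
  have \<beta>: "\<beta> \<ge> n * p / 8" "\<beta> > 0" "real d = 2 * \<beta>" using d np unfolding \<beta>_def by linarith+
  \<comment> \<open>The bound on the colour conflicts at \<open>v\<close> is proportional to
    \<open>card (A v)\<close>; trimming all lists to the same size \<open>d\<close> lets one \<beta>
    serve every slot.\<close>
  have "\<exists>B\<subseteq>E \<inter> incident V v. card B = d" if "v \<in> V" for v
  proof -
    have "d \<le> card (E \<inter> incident V v)" using deg[OF that] unfolding d_def by (simp add: nat_le_iff ceiling_le_iff)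
    then show ?thesis by (metis obtain_subset_with_card_n)
  qed
  then obtain A where A: "\<And>v. v \<in> V \<Longrightarrow> A v \<subseteq> E \<inter> incident V v" "\<And>v. v \<in> V \<Longrightarrow> card (A v) = d" by metis
  have A': "A v \<subseteq> {e \<in> E. v \<in> e}" if "v \<in> V" for v using A(1)[OF that] unfolding incident_def by auto
  have fA: "finite (A v)" if "v \<in> V" for v using A(1)[OF that] fE finite_subset by blast
  define I where "I = V \<times> {..<12::nat}"
  let ?A = "\<lambda>(v, i). A v :: nat set set"
  have fI: "finite I" unfolding I_def using fV by simp
  have fAI: "finite (?A x)" if "x \<in> I" for x using that fA unfolding I_def by auto
  \<comment> \<open>Only where the second term of \<open>density_bound\<close> dominates are the
    weights bounded by powers of \<open>card T / n\<close>. The other pairs are excluded at the end,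
    directly by density.\<close>
  define X where "X = {(S, T). S \<subseteq> T \<and> T \<subseteq> V \<and> card T = 3 * card S \<and> card S \<in> {1..s} \<and> sqrt (card T * n) * p > 4}"
  have fX: "finite X" by (rule finite_subset[of _ "Pow V \<times> Pow V"]) (use fV in \<open>auto simp: X_def\<close>)
  define Qc where "Qc = (\<lambda>(x, y). ({x, y}, mono_picks c ?A x y)) ` {(x, y) \<in> I \<times> I. x \<noteq> y}"
  define Qs where "Qs = (\<lambda>(S, T). (S \<times> {..<12::nat}, inner_picks A S T)) ` X"
  define \<omega> where "\<omega> q = real (card (snd q)) / \<beta> ^ (card (fst q) - 1)" for q :: "(nat \<times> nat) set \<times> (nat \<times> nat \<Rightarrow> nat set) set"
  have \<omega>: "\<omega> q \<ge> 0" for q unfolding \<omega>_def using \<beta> by simp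
  have fQc: "finite Qc" unfolding Qc_def
    by (rule finite_imageI, rule finite_subset[of _ "I \<times> I"]) (use fI in auto)
  have fQs: "finite Qs" unfolding Qs_def using fX by simp
  have inner: "finite (inner_picks A S T) \<and> \<omega> (S \<times> {..<12}, inner_picks A S T) \<le> \<beta> * (48 * sqrt (3 * real (card S) / n)) ^ (12 * card S)"
    if "(S, T) \<in> X" for S T
  proof -
    have ST: "S \<subseteq> T" "T \<subseteq> V" "card T = 3 * card S" "card S \<in> {1..s}" "sqrt (card T * n) * p > 4"
      using that unfolding X_def by auto
    define t where "t = 6 * (sqrt (card T * n) * p)"
    have fT: "finite T" using ST fV finite_subset by auto
    have t: "t > 0" unfolding t_def using ST(5) by simp
    have "real (card T) \<le> n / 10 ^ 8" using ST s by (simp add: field_simps)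
    moreover have "T \<noteq> {}" using ST by auto
    ultimately have "real (card (E \<inter> all_pairs T)) \<le> card T * (sqrt (card T * n) * p)"
      using dens[OF ST(2)] ST(5) unfolding density_bound_def by (simp add: max_def split: if_splits)
    also have "\<dots> = t * card S / 2" unfolding t_def ST(3) by simp
    finally have e: "real (card (E \<inter> all_pairs T)) \<le> t * card S / 2" .
    have AS: "A v \<subseteq> {e \<in> E. v \<in> e}" if "v \<in> S" for v using that ST A' by blast
    note cip = card_inner_picks[OF fT ST(1) fE AS t e]
    let ?k = "12 * card S"
    have k: "?k \<ge> 1" using ST by auto
    have "\<omega> (S \<times> {..<12}, inner_picks A S T) = card (inner_picks A S T) / \<beta> ^ (?k - 1)"
      unfolding \<omega>_def by (simp add: card_cartesian_product mult.commute)
    also have "\<dots> \<le> t ^ ?k / \<beta> ^ (?k - 1)" using cip \<beta> by (intro divide_right_mono) auto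
    also have "\<dots> = \<beta> * (t / \<beta>) ^ ?k"
      using k \<beta>(2) by (cases ?k) (auto simp: power_divide field_simps)
    also have "\<dots> \<le> \<beta> * (48 * sqrt (3 * real (card S) / n)) ^ ?k"
    proof (intro mult_left_mono power_mono)
      \<comment> \<open>The factor 6 in \<open>t\<close> becomes 48 because \<beta> is only known to
        be at least \<open>n * p / 8\<close>.\<close>
      have "t = n * p / 8 * (48 * sqrt (card T / n))"
        unfolding t_def using n by (simp add: real_sqrt_mult real_sqrt_divide field_simps)
      also have "\<dots> \<le> \<beta> * (48 * sqrt (card T / n))" using \<beta> by (intro mult_right_mono) auto
      finally show "t / \<beta> \<le> 48 * sqrt (3 * real (card S) / n)" using \<beta> ST(3) by (simp add: field_simps)
    qed (use \<beta> t in auto)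
    finally show ?thesis using cip(1) by simp
  qed
  have Qs_sum: "sum \<omega> Qs \<le> \<beta> / 2"
  proof -
    have "sum \<omega> Qs \<le> (\<Sum>q\<in>X. \<omega> (case q of (S, T) \<Rightarrow> (S \<times> {..<12}, inner_picks A S T)))"
      unfolding Qs_def using sum_image_le[OF fX, of \<omega>] \<omega> by (simp add: o_def)
    also have "\<dots> \<le> (\<Sum>(S, T)\<in>X. \<beta> * (48 * sqrt (3 * real (card S) / n)) ^ (12 * card S))"
      using inner by (intro sum_mono) auto
    also have "\<dots> \<le> (\<Sum>u=1..s. real (card V choose (3 * u)) * 8 ^ u * (\<beta> * (48 * sqrt (3 * real u / n)) ^ (12 * u)))"
      using \<beta> by (intro sum_over_set_pairs[OF fV]) (auto simp: X_def)
    also have "\<dots> = \<beta> * (\<Sum>u=1..s. real (n choose (3 * u)) * 8 ^ u * (48 * sqrt (3 * real u / n)) ^ (12 * u))"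
      unfolding cV by (simp add: sum_distrib_left mult_ac)
    also have "\<dots> \<le> \<beta> * (1/2)" using inner_pick_weights[OF n s] \<beta> by (intro mult_left_mono) auto
    finally show ?thesis by simp
  qed
  have Qc_sum: "sum \<omega> {q \<in> Qc. x \<in> fst q} \<le> \<beta> / 2" if x: "x \<in> I" for x
  proof -
    obtain v i where vi: "x = (v, i)" "v \<in> V" using x unfolding I_def by auto
    have "{q \<in> Qc. x \<in> fst q} \<subseteq> (\<lambda>y. ({x, y}, mono_picks c ?A x y)) ` (I - {x})"
    proof
      fix q assume "q \<in> {q \<in> Qc. x \<in> fst q}"
      then have q: "q \<in> Qc" "x \<in> fst q" by simp_all
      from q(1) obtain z where z: "z \<in> {(x, y) \<in> I \<times> I. x \<noteq> y}" "q = (\<lambda>(x, y). ({x, y}, mono_picks c ?A x y)) z"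
        unfolding Qc_def by blast
      obtain a b where zab: "z = (a, b)" by (cases z)
      then have ab: "a \<in> I" "b \<in> I" "a \<noteq> b" "q = ({a, b}, mono_picks c ?A a b)" "x = a \<or> x = b"
        using z q(2) by simp_all
      then have "q = ({x, b}, mono_picks c ?A x b) \<and> b \<in> I - {x} \<or> q = ({x, a}, mono_picks c ?A x a) \<and> a \<in> I - {x}"
        using mono_picks_commute[of c ?A a b] insert_commute[of a b "{}"] by auto
      then show "q \<in> (\<lambda>y. ({x, y}, mono_picks c ?A x y)) ` (I - {x})" by blast
    qed
    then have "sum \<omega> {q \<in> Qc. x \<in> fst q} \<le> sum \<omega> ((\<lambda>y. ({x, y}, mono_picks c ?A x y)) ` (I - {x}))"
      using fI \<omega> by (intro sum_mono2) auto
    also have "\<dots> \<le> (\<Sum>y\<in>I - {x}. \<omega> ({x, y}, mono_picks c ?A x y))"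
      using sum_image_le[of "I - {x}" \<omega> "\<lambda>y. ({x, y}, mono_picks c ?A x y)"] fI \<omega> by (simp add: o_def)
    also have "\<dots> = (\<Sum>y\<in>I - {x}. card (mono_picks c ?A x y) / \<beta>)"
      unfolding \<omega>_def by (intro sum.cong) auto
    also have "\<dots> \<le> (\<Sum>y\<in>I. card (mono_picks c ?A x y) / \<beta>)"
      using fI \<beta> by (intro sum_mono2) auto
    also have "\<dots> = (\<Sum>y\<in>I. real (card (mono_picks c ?A x y))) / \<beta>" by (simp add: sum_divide_distrib)
    \<comment> \<open>As \<open>card (A v)\<close> is twice \<beta>, this equals
      \<open>48 * n * p / 768 = n * p / 16\<close>; the constant 768 makes it fit into half of
      \<beta>.\<close>
    also have "\<dots> \<le> card (A v) * (2 * 12 * (n * p / 768)) / \<beta>"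
      using sum_card_mono_picks[OF fV fE E A' c vi(2), where k = 12 and i = i] \<beta>
      unfolding I_def vi(1) by (intro divide_right_mono) auto
    also have "\<dots> = n * p / 16" using A(2)[OF vi(2)] \<beta> by simp
    also have "\<dots> \<le> \<beta> / 2" using \<beta>(1) by linarith
    finally show ?thesis .
  qed
  have "avoiding ?A (Qc \<union> Qs) I \<noteq> {}"
  proof (rule avoiding_nonempty[OF fI fAI _ _ \<beta>(2)])
    show "finite (Qc \<union> Qs)" using fQc fQs by simp
    fix J F assume "(J, F) \<in> Qc \<union> Qs"
    then show "finite F \<and> J \<noteq> {}"
    proof
      assume "(J, F) \<in> Qc"
      then obtain x y where "x \<in> I" "y \<in> I" "J = {x, y}" "F = mono_picks c ?A x y" unfolding Qc_def by auto
      then show ?thesis using card_mono_picks(1)[of ?A x y c] fAI by auto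
    next
      assume "(J, F) \<in> Qs"
      then obtain S T where ST: "(S, T) \<in> X" "J = S \<times> {..<12}" "F = inner_picks A S T" unfolding Qs_def by auto
      then have "S \<noteq> {}" unfolding X_def by auto
      then have "J \<noteq> {}" unfolding ST(2) by (auto simp: lessThan_empty_iff)
      then show ?thesis using inner[OF ST(1)] ST(3) by simp
    qed
  next
    fix x assume x: "x \<in> I"
    \<comment> \<open>The total weight of all expansion events is already within budget, so for them
      the restriction \<open>x \<in> J\<close> is dropped.\<close>
    have "{(J, F) \<in> Qc \<union> Qs. x \<in> J} \<subseteq> {q \<in> Qc. x \<in> fst q} \<union> Qs" by auto
    then have "sum \<omega> {(J, F) \<in> Qc \<union> Qs. x \<in> J} \<le> sum \<omega> ({q \<in> Qc. x \<in> fst q} \<union> Qs)"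
      using fQc fQs \<omega> by (intro sum_mono2) auto
    also have "\<dots> \<le> sum \<omega> {q \<in> Qc. x \<in> fst q} + sum \<omega> Qs"
      using fQc fQs \<omega> by (subst sum_Un) (auto intro: sum_nonneg)
    also have "\<dots> \<le> \<beta>" using Qs_sum Qc_sum[OF x] by simp
    finally have "sum \<omega> {(J, F) \<in> Qc \<union> Qs. x \<in> J} \<le> \<beta>" .
    moreover have "card (?A x) = d" using x A(2) unfolding I_def by auto
    moreover have "(\<Sum>(J, F)\<in>{(J, F) \<in> Qc \<union> Qs. x \<in> J}. real (card F) / \<beta> ^ (card J - 1)) = sum \<omega> {(J, F) \<in> Qc \<union> Qs. x \<in> J}"
      unfolding \<omega>_def by (simp add: case_prod_unfold)
    ultimately show "\<beta> + (\<Sum>(J, F)\<in>{(J, F) \<in> Qc \<union> Qs. x \<in> J}. real (card F) / \<beta> ^ (card J - 1)) \<le> real (card (?A x))"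
      using \<beta>(3) by simp
  qed
  then obtain f where f: "f \<in> avoiding ?A (Qc \<union> Qs) I" by auto
  then have fI': "f \<in> PiE I ?A" and all: "\<forall>(J, F)\<in>Qc \<union> Qs. J \<subseteq> I \<longrightarrow> restrict f J \<notin> F"
    unfolding avoiding_def by blast+
  have fQ: "restrict f J \<notin> F" if "(J, F) \<in> Qc \<union> Qs" "J \<subseteq> I" for J F
    using bspec[OF all that(1)] that(2) by simp
  have fx: "f (v, i) \<in> A v" if "v \<in> V" "i < 12" for v i
    using PiE_mem[OF fI', of "(v, i)"] that unfolding I_def by simp
  have colours: "c (f x) \<noteq> c (f y)" if xy: "x \<in> I" "y \<in> I" "x \<noteq> y" for x y
  proof
    assume eq: "c (f x) = c (f y)"
    have "restrict f {x, y} \<in> mono_picks c ?A x y"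
      unfolding mono_picks_def using PiE_mem[OF fI'] xy eq by (auto intro!: restrict_PiE)
    moreover have "({x, y}, mono_picks c ?A x y) \<in> Qc" unfolding Qc_def using xy by force
    ultimately show False using fQ[of "{x, y}"] xy by auto
  qed
  define R where "R = f ` I"
  have RE: "R \<subseteq> E"
  proof
    fix e assume "e \<in> R"
    then obtain v i where "v \<in> V" "i < 12" "e = f (v, i)" unfolding R_def I_def by auto
    then show "e \<in> E" using fx A(1) by blast
  qed
  have "inj_on c R" unfolding R_def using colours by (auto simp: inj_on_def)
  moreover have "card R \<le> 12 * n"
    using card_image_le[OF fI, of f] cV unfolding R_def I_def by (simp add: card_cartesian_product mult.commute)
  moreover have "expander V R s"
    unfolding expander_def
  proof (intro allI impI)
    fix S assume S: "S \<subseteq> V" "S \<noteq> {} \<and> card S \<le> s"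
    have fS: "finite S" using S fV finite_subset by auto
    show "2 * card S < card (nbhd R S)"
    proof (rule ccontr)
      assume small: "\<not> 2 * card S < card (nbhd R S)"
      have nV: "nbhd R S \<subseteq> V" using RE E by (intro nbhd_subset) auto
      let ?T0 = "S \<union> nbhd R S"
      have "card ?T0 \<le> 3 * card S" using card_Un_le[of S "nbhd R S"] small by simp
      moreover have sz: "3 * card S \<le> n / 10 ^ 8" using S(2) s by (simp add: field_simps)
      moreover have "3 * card S \<le> card V"
      proof -
        have "real (3 * card S) \<le> real n" using sz by simp
        then show ?thesis unfolding cV by linarith
      qed
      \<comment> \<open>Enlarging to exactly \<open>3 * card S\<close> vertices matches the form of
        the bad events.\<close>
      ultimately obtain T where T: "?T0 \<subseteq> T" "T \<subseteq> V" "card T = 3 * card S"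
        using exists_subset_between[of ?T0 "3 * card S" V] S nV fV by auto
      have cS: "card S \<ge> 1" using S fS by (simp add: Suc_le_eq card_gt_0_iff)
      have inside: "f (v, i) \<in> A v \<inter> all_pairs T" if vi: "v \<in> S" "i < 12" for v i
      proof -
        have vV: "v \<in> V" using vi S by auto
        have "f (v, i) \<in> R" unfolding R_def I_def using vV vi by auto
        have "f (v, i) \<in> incident V v" using fx[OF vV vi(2)] A(1)[OF vV] by auto
        then have "card (f (v, i)) = 2" "v \<in> f (v, i)" unfolding incident_def all_pairs_def by auto
        then obtain y where y: "f (v, i) = {v, y}" "v \<noteq> y"
          by (metis card_2_iff insertE insert_commute singletonD)
        have "y \<in> ?T0" using \<open>f (v, i) \<in> R\<close> y vi unfolding nbhd_def by auto
        then have "f (v, i) \<in> all_pairs T" using T(1) y vi unfolding all_pairs_def by auto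
        then show ?thesis using fx[OF vV vi(2)] by simp
      qed
      have sub: "S \<times> {..<12} \<subseteq> I" unfolding I_def using S by auto
      show False
      proof (cases "sqrt (card T * n) * p > 4")
        case True
        then have "(S, T) \<in> X" unfolding X_def using T S cS by auto
        then have "(S \<times> {..<12}, inner_picks A S T) \<in> Qc \<union> Qs" unfolding Qs_def by force
        moreover have "restrict f (S \<times> {..<12}) \<in> inner_picks A S T"
          unfolding inner_picks_def using inside by auto
        ultimately show False using fQ sub by blast
      next
        case False
        \<comment> \<open>Different colours force different edges, so \<open>T\<close> contains
          \<open>12 * card S = 4 * card T\<close> edges, exactly the number that
          \<open>density_bound\<close> forbids here.\<close>
        have "inj_on f (S \<times> {..<12})" using colours sub by (metis inj_onI subsetD)
        then have "card (S \<times> {..<12::nat}) = card (f ` (S \<times> {..<12}))" by (simp add: card_image)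
        also have "\<dots> \<le> card (E \<inter> all_pairs T)"
        proof (rule card_mono)
          show "f ` (S \<times> {..<12}) \<subseteq> E \<inter> all_pairs T"
            using inside A(1) S(1) by blast
        qed (use fE in auto)
        finally have "12 * card S \<le> card (E \<inter> all_pairs T)" by (simp add: card_cartesian_product)
        moreover have "T \<noteq> {}" using T(3) cS by auto
        ultimately show False using dens[OF T(2)] T(3) sz False unfolding density_bound_def
          by (simp add: max_def split: if_splits)
      qed
    qed
  qed
  ultimately show ?thesis using that RE by blast
qed

text \<open>Adding a booster raises \<open>card R\<close> by one and the potential by at least one,
  so the last hypothesis on \<open>R\<close> is an invariant; as the potential never exceeds
  \<open>2 * card V + 1\<close>, it keeps \<open>card R \<le> K\<close>. The colours of
  \<open>R\<close> then cover at most \<open>K * \<Delta>\<close> edges, and some booster in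
  \<open>E\<close> has a new colour.\<close>

lemma rainbow_hamilton_from_boosters:
  fixes c :: "'v set \<Rightarrow> 'c" and K :: nat and \<Delta> :: real
  assumes V: "finite V" and E: "E \<subseteq> all_pairs V" and c: "globally_bounded E c \<Delta>" and \<Delta>: "\<Delta> \<ge> 0"
    and boost: "\<And>R. R \<subseteq> E \<Longrightarrow> card R \<le> K \<Longrightarrow> expander V R s \<Longrightarrow> \<not> (\<exists>H. hamilton_cycle V R H)
      \<Longrightarrow> real (card (E \<inter> boosters V R)) > K * \<Delta>"
    and R: "R \<subseteq> E" "inj_on c R" "expander V R s" "card R + (2 * card V + 1) \<le> K + cycle_potential V R"
  shows "\<exists>H. hamilton_cycle V E H \<and> rainbow c H"
  using R
proof (induction "2 * card V + 1 - cycle_potential V R" arbitrary: R rule: less_induct)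
  case less
  have fE: "finite E" using E finite_all_pairs[OF V] finite_subset by auto
  then have fR: "finite R" using less.prems finite_subset by auto
  show ?case
  proof (cases "\<exists>H. hamilton_cycle V R H")
    case True
    then obtain H where H: "hamilton_cycle V R H" by auto
    then have "H \<subseteq> R" unfolding hamilton_cycle_def by auto
    then have "rainbow c H" unfolding rainbow_def using less.prems(2) inj_on_subset by blast
    moreover have "hamilton_cycle V E H" using H less.prems(1) unfolding hamilton_cycle_def by auto
    ultimately show ?thesis by auto
  next
    case False
    have cR: "card R \<le> K" using less.prems(4) cycle_potential_le[OF V, of R] by linarith
    let ?B = "{e \<in> E. c e \<in> c ` R}"
    have "?B \<subseteq> (\<Union>a\<in>c ` R. {e \<in> E. c e = a})" by auto
    then have "card ?B \<le> card (\<Union>a\<in>c ` R. {e \<in> E. c e = a})" using fR fE by (intro card_mono) auto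
    also have "\<dots> \<le> (\<Sum>a\<in>c ` R. card {e \<in> E. c e = a})" using fR by (intro card_UN_le) auto
    finally have "real (card ?B) \<le> real (\<Sum>a\<in>c ` R. card {e \<in> E. c e = a})" by (simp only: of_nat_le_iff)
    also have "\<dots> = (\<Sum>a\<in>c ` R. real (card {e \<in> E. c e = a}))" by simp
    also have "\<dots> \<le> (\<Sum>a\<in>c ` R. \<Delta>)" using c unfolding globally_bounded_def by (intro sum_mono) auto
    also have "\<dots> = card (c ` R) * \<Delta>" by simp
    also have "\<dots> \<le> K * \<Delta>" using card_image_le[OF fR, of c] cR \<Delta> by (intro mult_right_mono) auto
    also have "\<dots> < card (E \<inter> boosters V R)" by (rule boost[OF less.prems(1) cR less.prems(3) False])
    finally have "card ?B < card (E \<inter> boosters V R)" by simp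
    then have "\<not> E \<inter> boosters V R \<subseteq> ?B" using fE card_mono[of ?B "E \<inter> boosters V R"] by auto
    then obtain e where e: "e \<in> E" "e \<in> boosters V R" "c e \<notin> c ` R" by auto
    have eR: "e \<notin> R" using e by auto
    have up: "cycle_potential V R < cycle_potential V (insert e R)" using e(2) unfolding boosters_def by auto
    show ?thesis
    proof (rule less.hyps)
      show "2 * card V + 1 - cycle_potential V (insert e R) < 2 * card V + 1 - cycle_potential V R"
        using up cycle_potential_le[OF V, of "insert e R"] by linarith
      show "insert e R \<subseteq> E" using e less.prems by auto
      show "inj_on c (insert e R)" using e less.prems(2) eR by auto
      show "expander V (insert e R) s"
        using expander_mono[OF less.prems(3), of "insert e R"] V E e less.prems(1) by auto
      show "card (insert e R) + (2 * card V + 1) \<le> K + cycle_potential V (insert e R)"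
        using up less.prems(4) fR eR by simp
    qed
  qed
qed

section \<open>Rainbow Hamilton cycles\<close>

text \<open>The deterministic half of the argument. The typical properties are phrased as negations
  so that they are literally the complements of the bad events. Of the upper bounds on \<mu>,
  \<open>1 / 768\<close> serves the expander and \<open>c\<^sub>0 / 60\<close> the boosters.\<close>

lemma rainbow_hamilton_pseudorandom:
  fixes n :: nat and p c\<^sub>0 \<mu> :: real
  defines "V \<equiv> {..<n}"
  assumes n: "n \<ge> 1" and p: "0 < p"
    and E: "E \<subseteq> all_pairs V"
    and deg: "\<not> (\<exists>v<n. real (card (E \<inter> incident V v)) \<le> n * p / 4)"
    and dens: "\<not> (\<exists>U\<subseteq>V. U \<noteq> {} \<and> card U \<le> 1 / 10 ^ 8 * n
        \<and> real (card (E \<inter> all_pairs U)) \<ge> density_bound n p (card U))"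
    and boost: "\<not> (\<exists>R\<in>{R. R \<subseteq> all_pairs V \<and> card R \<le> 15 * n \<and> expander V R s \<and> \<not> (\<exists>H. hamilton_cycle V R H)}.
        R \<subseteq> E \<and> real (card (E \<inter> boosters V R)) \<le> c\<^sub>0 * (real n)\<^sup>2 * p / 4)"
    and s: "3 * s \<le> n / 10 ^ 8" and \<mu>: "0 \<le> \<mu>" "\<mu> \<le> 1 / 768" "\<mu> \<le> c\<^sub>0 / 60"
  shows "rainbow_hamilton_property n (\<mu> * n * p) E"
  unfolding rainbow_hamilton_property_def
proof (intro allI impI)
  fix c :: "nat set \<Rightarrow> nat" assume c: "globally_bounded E c (\<mu> * n * p)"
  have "\<mu> * n * p \<le> 1 / 768 * n * p" using \<mu> p by (intro mult_right_mono) auto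
  then have le: "\<mu> * n * p \<le> n * p / 768" by simp
  have c': "globally_bounded E c (n * p / 768)"
    unfolding globally_bounded_def
  proof
    fix k
    show "real (card {e \<in> E. c e = k}) \<le> n * p / 768"
      using spec[OF c[unfolded globally_bounded_def], of k] le by linarith
  qed
  obtain R where R: "R \<subseteq> E" "inj_on c R" "card R \<le> 12 * n" "expander V R s"
  proof (rule rainbow_expander[OF n p E[unfolded V_def] _ _ s c'])
    show "real (card (E \<inter> incident {..<n} v)) \<ge> n * p / 4" if "v \<in> {..<n}" for v
      using deg that unfolding V_def by force
    show "real (card (E \<inter> all_pairs U)) < density_bound n p (card U)"
      if "U \<subseteq> {..<n}" "U \<noteq> {}" "card U \<le> n / 10 ^ 8" for U
      using dens that unfolding V_def by force
  qed (use that in \<open>auto simp: V_def\<close>)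
  have "\<exists>H. hamilton_cycle V E H \<and> rainbow c H"
  proof (rule rainbow_hamilton_from_boosters[OF _ E c _ _ R(1,2,4)])
    show "finite V" "0 \<le> \<mu> * n * p" using p \<mu> unfolding V_def by auto
    \<comment> \<open>Here \<open>12 * n + 2 * n + 1 \<le> 15 * n\<close>, as
      \<open>n \<ge> 1\<close>.\<close>
    show "card R + (2 * card V + 1) \<le> 15 * n + cycle_potential V R"
      using R(3) n unfolding V_def by simp
    fix R' assume R': "R' \<subseteq> E" "card R' \<le> 15 * n" "expander V R' s" "\<not> (\<exists>H. hamilton_cycle V R' H)"
    have "real (15 * n) * (\<mu> * n * p) = 15 * \<mu> * ((real n)\<^sup>2 * p)" by (simp add: power2_eq_square)
    also have "\<dots> \<le> c\<^sub>0 / 4 * ((real n)\<^sup>2 * p)" using \<mu> p by (intro mult_right_mono) auto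
    also have "\<dots> = c\<^sub>0 * (real n)\<^sup>2 * p / 4" by simp
    also have "\<dots> < real (card (E \<inter> boosters V R'))"
    proof (rule ccontr)
      assume "\<not> c\<^sub>0 * (real n)\<^sup>2 * p / 4 < real (card (E \<inter> boosters V R'))"
      then have "real (card (E \<inter> boosters V R')) \<le> c\<^sub>0 * (real n)\<^sup>2 * p / 4" by simp
      then show False using boost R' E by blast
    qed
    finally show "real (15 * n) * (\<mu> * n * p) < real (card (E \<inter> boosters V R'))" .
  qed
  then show "\<exists>H. hamilton_cycle {..<n} E H \<and> rainbow c H" unfolding V_def .
qed

lemma gnp_rainbow_hamilton:
  fixes n :: nat and p c\<^sub>0 \<mu> :: real
  assumes p: "0 < p" "p \<le> 1" and n: "n \<ge> 6 * 10 ^ 8"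
    and c\<^sub>0: "c\<^sub>0 = 1 / (72 * 10 ^ 16)" and \<mu>: "\<mu> = c\<^sub>0 / 60"
    and np: "n * p \<ge> 12 * ln n" "n * p \<ge> (15 * ln (5 / c\<^sub>0) + 1) / (3/20 * c\<^sub>0)"
  shows "measure_pmf.prob (gnp n p) {E. rainbow_hamilton_property n (\<mu> * n * p) E} \<ge> 1 - 51 / n"
proof -
  let ?V = "{..<n}" and ?M = "gnp n p"
  define s where "s = nat \<lfloor>real n / (3 * 10 ^ 8)\<rfloor>"
  have n1: "n \<ge> 1" using n by simp
  have s1: "real s \<le> real n / (3 * 10 ^ 8)" unfolding s_def by (rule of_nat_floor) simp
  \<comment> \<open>Rounding down loses at most one, which is at most half of the quotient because
    \<open>n \<ge> 6 * 10 ^ 8\<close>.\<close>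
  have s2: "real s \<ge> real n / (6 * 10 ^ 8)"
  proof -
    have "real s > real n / (3 * 10 ^ 8) - 1" unfolding s_def by linarith
    moreover have "real n / (6 * 10 ^ 8) \<ge> 1" using n by simp
    ultimately show ?thesis by simp
  qed
  have "real s \<ge> 1" using s2 n by (simp add: field_simps)
  then have s0: "s \<ge> 1" by simp
  let ?F = "{R. R \<subseteq> all_pairs ?V \<and> card R \<le> 15 * n \<and> expander ?V R s \<and> \<not> (\<exists>H. hamilton_cycle ?V R H)}"
  define B1 where "B1 = {E. \<exists>v<n. real (card (E \<inter> incident ?V v)) \<le> n * p / 4}"
  define B2 where "B2 = {E. \<exists>U\<subseteq>?V. U \<noteq> {} \<and> card U \<le> 1 / 10 ^ 8 * n
        \<and> real (card (E \<inter> all_pairs U)) \<ge> density_bound n p (card U)}"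
  define B3 where "B3 = {E. \<exists>R\<in>?F. R \<subseteq> E \<and> real (card (E \<inter> boosters ?V R)) \<le> c\<^sub>0 * (real n)\<^sup>2 * p / 4}"
  have "measure_pmf.prob ?M B1 \<le> 2 / n"
  proof -
    have "measure_pmf.prob ?M B1 \<le> n * exp (1/2 - n * p / 4)"
      unfolding B1_def using p n1 by (intro gnp_min_degree) auto
    \<comment> \<open>The factor 12 gives \<open>n ^ 3\<close> in the denominator, more than the
      \<open>n\<close> vertices of the union bound.\<close>
    also have "\<dots> \<le> n * exp (1/2 - 3 * ln n)" using np(1) by (intro mult_left_mono) auto
    also have "\<dots> = exp (1/2) / n ^ 2"
    proof -
      have "exp (3 * ln n) = real n ^ 3" using n1 exp_of_nat_mult[of 3 "ln n"] by simp
      then show ?thesis using n1 by (simp add: exp_diff power_numeral_reduce)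
    qed
    also have "\<dots> \<le> 2 / n ^ 2"
    proof -
      have "exp (1/2) \<le> (2::real)"
        using exp_le exp_of_nat_mult[of 2 "1/2 :: real"] power2_le_imp_le[of "exp (1/2 :: real)" 2] by simp
      then show ?thesis by (intro divide_right_mono) auto
    qed
    also have "\<dots> \<le> 2 / n" using n1 by (simp add: field_simps power2_eq_square)
    finally show ?thesis .
  qed
  moreover have "measure_pmf.prob ?M B2 \<le> 48 / n"
    unfolding B2_def using p n1 by (intro gnp_sparse_sets) auto
  moreover have "measure_pmf.prob ?M B3 \<le> 1 / n"
  proof -
    have "measure_pmf.prob ?M B3 \<le> exp (15 * n * ln (5 / c\<^sub>0) - 3/20 * c\<^sub>0 * (real n)\<^sup>2 * p)"
    proof -
      have "measure_pmf.prob ?M B3 \<le> exp (real 15 * n * ln (5 / c\<^sub>0) - 3/20 * c\<^sub>0 * (real n)\<^sup>2 * p)"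
        unfolding B3_def
      proof (rule gnp_many_edges_in)
        fix R assume R: "R \<in> ?F"
        then show "R \<subseteq> all_pairs ?V \<and> card R \<le> 15 * n" by simp
        have "?V \<noteq> {}" using n1 by (auto simp: lessThan_empty_iff)
        then have "s * s \<le> 2 * card (boosters ?V R)"
          using R s0 by (intro many_boosters) auto
        then have "real (s * s) \<le> real (2 * card (boosters ?V R))" by (simp only: of_nat_le_iff)
        then have "real s * real s \<le> 2 * real (card (boosters ?V R))" by simp
        moreover have "real n / (6 * 10 ^ 8) * (real n / (6 * 10 ^ 8)) \<le> real s * real s"
          using s2 by (intro mult_mono) auto
        \<comment> \<open>The constant \<open>c\<^sub>0\<close> is half the square of
          \<open>1 / (6 * 10 ^ 8)\<close>, from \<open>s * s / 2\<close> boosters.\<close>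
        ultimately have "c\<^sub>0 * (real n)\<^sup>2 \<le> real (card (boosters ?V R))"
          unfolding c\<^sub>0 by (simp add: power2_eq_square)
        moreover have "R \<inter> boosters ?V R = {}" using boosters_disjoint[of ?V R] by auto
        ultimately show "boosters ?V R \<subseteq> all_pairs ?V \<and> R \<inter> boosters ?V R = {} \<and> real (card (boosters ?V R)) \<ge> c\<^sub>0 * (real n)\<^sup>2"
          unfolding boosters_def by auto
      qed (use p c\<^sub>0 in auto)
      then show ?thesis by simp
    qed
    also have "\<dots> \<le> exp (- n)"
    proof -
      have c: "c\<^sub>0 > 0" unfolding c\<^sub>0 by simp
      \<comment> \<open>The summand 1 is what remains of the exponent per vertex: it becomes
        \<open>- n\<close>.\<close>
      have "15 * ln (5 / c\<^sub>0) + 1 \<le> 3/20 * c\<^sub>0 * (n * p)" using np(2) c by (simp add: field_simps)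
      then have "n * (15 * ln (5 / c\<^sub>0) + 1) \<le> n * (3/20 * c\<^sub>0 * (n * p))" by (intro mult_left_mono) auto
      then show ?thesis by (simp add: algebra_simps power2_eq_square)
    qed
    also have "\<dots> = 1 / exp n" by (simp add: exp_minus field_simps)
    also have "\<dots> \<le> 1 / n"
    proof -
      have "real n \<le> exp n" using exp_ge_add_one_self[of "real n"] by linarith
      then show ?thesis using n1 by (intro divide_left_mono) auto
    qed
    finally show ?thesis .
  qed
  moreover have "measure_pmf.prob ?M (B1 \<union> B2 \<union> B3)
      \<le> measure_pmf.prob ?M B1 + measure_pmf.prob ?M B2 + measure_pmf.prob ?M B3"
    using measure_Un_le[of "B1 \<union> B2" ?M B3] measure_Un_le[of B1 ?M B2] by simp
  ultimately have bad: "measure_pmf.prob ?M (B1 \<union> B2 \<union> B3) \<le> 51 / n" by simp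
  have "1 - measure_pmf.prob ?M (B1 \<union> B2 \<union> B3) = measure_pmf.prob ?M (- (B1 \<union> B2 \<union> B3))"
    using measure_pmf.prob_compl[of "B1 \<union> B2 \<union> B3" ?M] by (simp add: Compl_eq_Diff_UNIV)
  also have "\<dots> \<le> measure_pmf.prob ?M {E. rainbow_hamilton_property n (\<mu> * n * p) E}"
  \<comment> \<open>The inclusion is only available on the support, where \<open>E\<close> consists
    of pairs from \<open>{..<n}\<close>.\<close>
  proof (rule measure_pmf.finite_measure_mono_AE)
    show "AE E in ?M. E \<in> - (B1 \<union> B2 \<union> B3) \<longrightarrow> E \<in> {E. rainbow_hamilton_property n (\<mu> * n * p) E}"
    proof (rule AE_pmfI, rule impI, rule CollectI)
      fix E assume E: "E \<in> set_pmf ?M" "E \<in> - (B1 \<union> B2 \<union> B3)"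
      then have "E \<notin> B1" "E \<notin> B2" "E \<notin> B3" by auto
      then show "rainbow_hamilton_property n (\<mu> * n * p) E"
        unfolding B1_def B2_def B3_def mem_Collect_eq
        by (rule rainbow_hamilton_pseudorandom[OF n1 p(1) set_pmf_gnp[OF E(1)]])
          (use s1 \<mu> c\<^sub>0 in simp_all)
    qed
  qed simp
  finally show ?thesis using bad by linarith
qed

theorem theorem1p4:
  "\<exists>\<mu>::real. \<mu> > 0 \<and>
     (\<forall>p :: nat \<Rightarrow> real.
        (\<forall>n. 0 \<le> p n \<and> p n \<le> 1) \<longrightarrow>
        much_greater p (\<lambda>n. ln (real n) / real n) \<longrightarrow>
        aas (\<lambda>n. gnp n (p n))
            (\<lambda>n E. rainbow_hamilton_property n (\<mu> * real n * p n) E))"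
proof -
  define c\<^sub>0 :: real where "c\<^sub>0 = 1 / (72 * 10 ^ 16)"
  define \<mu> where "\<mu> = c\<^sub>0 / 60"
  show ?thesis
  proof (intro exI[of _ \<mu>] conjI allI impI)
    show "\<mu> > 0" unfolding \<mu>_def c\<^sub>0_def by simp
    fix p :: "nat \<Rightarrow> real"
    assume p: "\<forall>n. 0 \<le> p n \<and> p n \<le> 1" and big: "much_greater p (\<lambda>n. ln (real n) / real n)"
    \<comment> \<open>Once \<open>ln n \<ge> 1\<close>, the single bound
      \<open>D * ln n \<le> n * p n\<close> yields both \<open>12 * ln n \<le> n * p n\<close> and
      the constant lower bound on \<open>n * p n\<close>.\<close>
    define D where "D = max 12 ((15 * ln (5 / c\<^sub>0) + 1) / (3/20 * c\<^sub>0))"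
    have "eventually (\<lambda>n. p n / (ln (real n) / real n) \<ge> D) sequentially"
      using big unfolding much_greater_def filterlim_at_top by simp
    moreover have "eventually (\<lambda>n. n \<ge> 6 * 10 ^ 8) sequentially" by (rule eventually_ge_at_top)
    ultimately have low: "eventually (\<lambda>n. 1 - 51 / real n
      \<le> measure_pmf.prob (gnp n (p n)) {E. rainbow_hamilton_property n (\<mu> * real n * p n) E}) sequentially"
    proof eventually_elim
      case (elim n)
      have l: "ln (real n) \<ge> 1"
      proof -
        have "3 \<le> real n" using elim(2) by simp
        then have "exp 1 \<le> real n" using exp_le by linarith
        then show ?thesis using elim(2) by (subst ln_ge_iff) auto
      qed
      have n: "real n > 0" using elim(2) by simp
      have "D \<le> n * p n / ln n" using elim(1) by (simp add: mult.commute)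
      then have D: "D * ln n \<le> n * p n" using l by (simp add: pos_le_divide_eq)
      have D12: "D \<ge> 12" "D \<ge> (15 * ln (5 / c\<^sub>0) + 1) / (3/20 * c\<^sub>0)" unfolding D_def by auto
      have "12 * ln n \<le> D * ln n" using D12 l by (intro mult_right_mono) auto
      then have np: "12 * ln n \<le> n * p n" using D by linarith
      have "D * 1 \<le> D * ln n" using D12 l by (intro mult_left_mono) auto
      then have np': "D \<le> n * p n" using D by linarith
      have "p n > 0"
      proof (rule ccontr)
        assume "\<not> p n > 0"
        then have "p n = 0" using p by (metis less_le)
        then show False using np l by simp
      qed
      then show ?case
        by (rule gnp_rainbow_hamilton[OF _ _ elim(2) c\<^sub>0_def \<mu>_def np order_trans[OF D12(2) np']])
          (use p in simp)
    qed
    have "(\<lambda>n. 51 / real n) \<longlonglongrightarrow> 0" by (rule lim_const_over_n)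
    then have "(\<lambda>n. 1 - 51 / real n) \<longlonglongrightarrow> 1 - 0" by (intro tendsto_diff tendsto_const)
    then have lim: "(\<lambda>n. 1 - 51 / real n) \<longlonglongrightarrow> 1" by simp
    show "aas (\<lambda>n. gnp n (p n)) (\<lambda>n E. rainbow_hamilton_property n (\<mu> * real n * p n) E)"
      unfolding aas_def
    proof (rule tendsto_sandwich[OF low _ lim tendsto_const])
      show "eventually (\<lambda>n. measure_pmf.prob (gnp n (p n)) {E. rainbow_hamilton_property n (\<mu> * real n * p n) E} \<le> 1) sequentially"
        by (intro always_eventually allI) (rule measure_pmf.prob_le_1)
    qed
  qed
qed

end
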